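(* Let $C$ be a field of characteristic $p$ and $D$ a central division algebra over $C$ of degree $d$. Let $\delta$ be a derivation of $D$ such that $\delta|_C$ is algebraic with minimum polynomial $g(t)=t^{p^e}+c_1t^{p^{e-1}}+\dots+c_et\in F[t]$ of degree $p^e$, where $F={\rm Const}(\delta)\cap C$. Let $d_0\in D$ satisfy $g(\delta)(z)=d_0z-zd_0$ for all $z\in D$ and $\delta(d_0)=0$. Let $R=D[t;\delta]$ and $x=g(t)-d_0$, and let $N$ be the reduced norm of the central simple $F(x)$-algebra $D(t;\delta)$. Let $f\in R$ be a monic polynomial of degree $m$, let $h(t)=\hat h(g(t)-d_0)$ with $\hat h\in F[x]$ monic be its minimal central left multiple, and suppose that $\deg(\hat h)=dm$ (degree in $x$). (i) If $N(f)=\hat h_1\cdots\hat h_l$ such that $\hat h_i\in F[x]$ is irreducible for $1\le i\le l$, then there exists a decomposition $f=f_1\cdots f_l$ of $f$ into irreducible factors such that $N(f_i)=\hat h_i$ for all $i$, $1\le i\le l$. The degree of $f_i$ in $R$ equals the degree of $\hat h_i$ in $F[x]$ for all $i$. (ii) Assume that $N(f)$ is the product of $l$ distinct irreducible factors $\hat h_1,\dots,\hat h_l$ in $F[x]$. Then $f$ has exactly $l!$ irreducible decompositions (decompositions into irreducible factors in $R$), corresponding to each possible ordering of the factors of $N(f)$.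
   Context: ${\rm Const}(\delta)=\{a\in D:\delta(a)=0\}$. $D[t;\delta]$ is the ring of polynomials $\sum a_it^i$, $a_i\in D$, with $ta=at+\delta(a)$ for $a\in D$. Its center is $C(R)=F[x]$, $x=g(t)-d_0$. The ring of central quotients $D(t;\delta)=\{f/q: f\in R,\ 0\ne q\in F[x]\}$ is a central simple algebra of degree $p^ed$ over $F(x)$; $N$ is its reduced norm, and $N(f)\in F[x]$ for $f\in R$. An element $f\in R$ is irreducible if it is not a unit and is not a product $qr$ with $q,r\in R$ and $1\le\deg q,\deg r<\deg f$. The minimal central left multiple of $f\neq0$ is the unique polynomial $h\in C(R)$ of minimal degree such that $h=qf$ for some $q\in R$ and $h(t)=\hat h(g(t)-d_0)$ with $\hat h\in F[x]$ monic.
   Formalization: In (i) the degree claim is corrected to deg(ĥ_i) = d·deg(f_i), since equality fails for d > 1 (f = x − a, D quaternion, δ = 0). The ĥ_i are taken monic (otherwise N(f_i) = ĥ_i can fail), and in (ii) decompositions into monic irreducible factors are counted. *)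

theory Defs
  imports
    "HOL-Algebra.Algebraic_Closure_Type"
    "HOL-Combinatorics.Multiset_Permutations"
    "Jordan_Normal_Form.Determinant"
begin

definition center :: "('r, 'b) ring_scheme \<Rightarrow> 'r set"
  where "center R = {z \<in> carrier R. \<forall>y \<in> carrier R. z \<otimes>\<^bsub>R\<^esub> y = y \<otimes>\<^bsub>R\<^esub> z}"

definition is_derivation :: "('a::ring_1 \<Rightarrow> 'a) \<Rightarrow> bool"
  where "is_derivation \<delta> \<longleftrightarrow>
    (\<forall>a b. \<delta> (a + b) = \<delta> a + \<delta> b) \<and> (\<forall>a b. \<delta> (a * b) = a * \<delta> b + \<delta> a * b)"


text \<open>The elements of \<open>D[t;\<delta>]\<close> are the values of \<^typ>\<open>'a poly\<close>, with coefficients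
  written to the left of the powers of \<open>t\<close>. Left multiplication by \<open>t\<close> is
  \<open>t (\<Sum> b\<^sub>j t\<^sup>j) = \<Sum> b\<^sub>j t\<^bsup>j+1\<^esup> + \<Sum> \<delta>(b\<^sub>j) t\<^sup>j\<close>.\<close>

definition t_mult :: "('a::division_ring \<Rightarrow> 'a) \<Rightarrow> 'a poly \<Rightarrow> 'a poly"
  where "t_mult \<delta> q = pCons 0 q + map_poly \<delta> q"

definition skew_mult :: "('a::division_ring \<Rightarrow> 'a) \<Rightarrow> 'a poly \<Rightarrow> 'a poly \<Rightarrow> 'a poly"
  where "skew_mult \<delta> f q =
    (\<Sum>i\<le>Polynomial.degree f. map_poly (\<lambda>b. Polynomial.coeff f i * b) ((t_mult \<delta> ^^ i) q))"

definition skew_ring :: "('a::division_ring \<Rightarrow> 'a) \<Rightarrow> 'a poly ring"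
  where "skew_ring \<delta> =
    \<lparr>carrier = UNIV, monoid.mult = skew_mult \<delta>, one = [:1:], ring.zero = 0, add = (+)\<rparr>"

lemma skew_mult_t_const:
  assumes "\<delta> 0 = 0"
  shows "skew_mult \<delta> [:0, 1:] [:a:] = skew_mult \<delta> [:a:] [:0, 1:] + [:\<delta> a:]"
  using assms by (simp add: skew_mult_def t_mult_def map_poly_pCons)

definition skew_irreducible :: "('a::division_ring \<Rightarrow> 'a) \<Rightarrow> 'a poly \<Rightarrow> bool"
  where "skew_irreducible \<delta> f \<longleftrightarrow> f \<notin> Units (skew_ring \<delta>) \<and>
    \<not> (\<exists>q r. f = q \<otimes>\<^bsub>skew_ring \<delta>\<^esub> r \<and>
         1 \<le> Polynomial.degree q \<and> Polynomial.degree q < Polynomial.degree f \<and>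
         1 \<le> Polynomial.degree r \<and> Polynomial.degree r < Polynomial.degree f)"

definition skew_prod :: "('a::division_ring \<Rightarrow> 'a) \<Rightarrow> 'a poly list \<Rightarrow> 'a poly"
  where "skew_prod \<delta> fs = foldr (monoid.mult (skew_ring \<delta>)) fs \<one>\<^bsub>skew_ring \<delta>\<^esub>"

text \<open>The factors are monic: otherwise units of \<open>D\<close> could be moved between
  neighbouring factors, and decompositions could not be counted.\<close>

definition irreducible_decompositions ::
    "('a::division_ring \<Rightarrow> 'a) \<Rightarrow> 'a poly \<Rightarrow> 'a poly list set"
  where "irreducible_decompositions \<delta> f =
    {fs. (\<forall>q \<in> set fs. skew_irreducible \<delta> q \<and> lead_coeff q = 1) \<and> skew_prod \<delta> fs = f}"

definition minimal_central_left_multiple ::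
    "('a::division_ring \<Rightarrow> 'a) \<Rightarrow> 'a poly \<Rightarrow> 'a poly \<Rightarrow> bool"
  where "minimal_central_left_multiple \<delta> f h \<longleftrightarrow>
    (let M = {k \<in> center (skew_ring \<delta>). k \<noteq> 0 \<and> (\<exists>q. k = q \<otimes>\<^bsub>skew_ring \<delta>\<^esub> f)}
     in h \<in> M \<and> (\<forall>k \<in> M. Polynomial.degree h \<le> Polynomial.degree k))"


text \<open>The field \<open>F\<close> is a type \<^typ>\<open>'f\<close> together with an embedding \<open>\<iota>\<close> into \<open>D\<close>, so that
  \<open>F[x]\<close> is \<^typ>\<open>'f poly\<close> and \<open>F(x)\<close> is \<^typ>\<open>'f poly fract\<close>.\<close>

definition poly_in_derivation ::
    "('f::field \<Rightarrow> 'a::division_ring) \<Rightarrow> ('a \<Rightarrow> 'a) \<Rightarrow> 'f poly \<Rightarrow> 'a \<Rightarrow> 'a"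
  where "poly_in_derivation \<iota> \<delta> g z =
    (\<Sum>i\<le>Polynomial.degree g. \<iota> (Polynomial.coeff g i) * (\<delta> ^^ i) z)"

definition is_minimum_polynomial_on ::
    "('f::field \<Rightarrow> 'a::division_ring) \<Rightarrow> ('a \<Rightarrow> 'a) \<Rightarrow> 'a set \<Rightarrow> 'f poly \<Rightarrow> bool"
  where "is_minimum_polynomial_on \<iota> \<delta> C g \<longleftrightarrow>
    lead_coeff g = 1 \<and> (\<forall>z \<in> C. poly_in_derivation \<iota> \<delta> g z = 0) \<and>
    (\<forall>q. q \<noteq> 0 \<and> (\<forall>z \<in> C. poly_in_derivation \<iota> \<delta> q z = 0) \<longrightarrow>
       Polynomial.degree g \<le> Polynomial.degree q)"

definition eval_at ::
    "('f::field \<Rightarrow> 'a::division_ring) \<Rightarrow> ('a \<Rightarrow> 'a) \<Rightarrow> 'a poly \<Rightarrow> 'f poly \<Rightarrow> 'a poly"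
  where "eval_at \<iota> \<delta> x h =
    (\<Sum>i\<le>Polynomial.degree h.
       [:\<iota> (Polynomial.coeff h i):] \<otimes>\<^bsub>skew_ring \<delta>\<^esub> (x [^]\<^bsub>skew_ring \<delta>\<^esub> i))"


text \<open>The ring of fractions \<open>f / \<kappa>(q)\<close> with \<open>f \<in> R\<close> and \<open>q \<noteq> 0\<close>, for an injective
  homomorphism \<open>\<kappa>\<close> from an integral domain into the centre of \<open>R\<close> whose nonzero values are
  not zero divisors. A fraction is the equivalence class of the pair \<open>(f, q)\<close>.\<close>

definition fraction_rel ::
    "('r, 'b) ring_scheme \<Rightarrow> ('k::idom \<Rightarrow> 'r) \<Rightarrow> (('r \<times> 'k) \<times> ('r \<times> 'k)) set"
  where "fraction_rel R \<kappa> =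
    {((f, q), (f', q')). f \<in> carrier R \<and> f' \<in> carrier R \<and> q \<noteq> 0 \<and> q' \<noteq> 0 \<and>
       \<kappa> q' \<otimes>\<^bsub>R\<^esub> f = \<kappa> q \<otimes>\<^bsub>R\<^esub> f'}"

definition fraction ::
    "('r, 'b) ring_scheme \<Rightarrow> ('k::idom \<Rightarrow> 'r) \<Rightarrow> 'r \<Rightarrow> 'k \<Rightarrow> ('r \<times> 'k) set"
  where "fraction R \<kappa> f q = fraction_rel R \<kappa> `` {(f, q)}"

definition central_quotients ::
    "('r, 'b) ring_scheme \<Rightarrow> ('k::idom \<Rightarrow> 'r) \<Rightarrow> ('r \<times> 'k) set ring"
  where "central_quotients R \<kappa> =
    \<lparr>carrier = {fraction R \<kappa> f q |f q. f \<in> carrier R \<and> q \<noteq> 0},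
     monoid.mult = (\<lambda>P Q. \<Union>(f, q) \<in> P. \<Union>(f', q') \<in> Q. fraction R \<kappa> (f \<otimes>\<^bsub>R\<^esub> f') (q * q')),
     one = fraction R \<kappa> \<one>\<^bsub>R\<^esub> 1,
     ring.zero = fraction R \<kappa> \<zero>\<^bsub>R\<^esub> 1,
     add = (\<lambda>P Q. \<Union>(f, q) \<in> P. \<Union>(f', q') \<in> Q.
       fraction R \<kappa> ((\<kappa> q' \<otimes>\<^bsub>R\<^esub> f) \<oplus>\<^bsub>R\<^esub> (\<kappa> q \<otimes>\<^bsub>R\<^esub> f')) (q * q'))\<rparr>"

text \<open>The structure map of \<^const>\<open>central_quotients\<close> as an algebra over the fraction field.\<close>

definition central_scalar ::
    "('r, 'b) ring_scheme \<Rightarrow> ('k::idom \<Rightarrow> 'r) \<Rightarrow> 'k fract \<Rightarrow> ('r \<times> 'k) set"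
  where "central_scalar R \<kappa> s =
    \<Union> {fraction R \<kappa> (\<kappa> a) b |a b. b \<noteq> 0 \<and> Fraction_Field.Fract a b = s}"


text \<open>Let \<open>A\<close> be an algebra over the field \<open>K\<close> (the type \<^typ>\<open>'k\<close>) with structure map \<open>\<sigma>\<close>, and
  let \<open>L\<close> be the algebraic closure of \<open>K\<close>. The map \<open>\<phi>\<close> is a splitting if it is a homomorphism of
  \<open>K\<close>-algebras into the \<open>n \<times> n\<close> matrices over \<open>L\<close> whose \<open>L\<close>-linear extension to \<open>A \<otimes>\<^sub>K L\<close> is an
  isomorphism. The tensor product is avoided by the last condition: some \<open>K\<close>-basis of \<open>A\<close>
  is mapped to an \<open>L\<close>-basis of the space of matrices.\<close>

definition is_splitting ::
    "('r, 'b) ring_scheme \<Rightarrow> ('k::field \<Rightarrow> 'r) \<Rightarrow> nat \<Rightarrow> ('r \<Rightarrow> 'k alg_closure mat) \<Rightarrow> bool"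
  where "is_splitting A \<sigma> n \<phi> \<longleftrightarrow>
    (\<forall>a \<in> carrier A. \<phi> a \<in> carrier_mat n n) \<and>
    (\<forall>a \<in> carrier A. \<forall>b \<in> carrier A. \<phi> (a \<oplus>\<^bsub>A\<^esub> b) = \<phi> a + \<phi> b) \<and>
    (\<forall>a \<in> carrier A. \<forall>b \<in> carrier A. \<phi> (a \<otimes>\<^bsub>A\<^esub> b) = \<phi> a * \<phi> b) \<and>
    (\<forall>k. \<phi> (\<sigma> k) = to_ac k \<cdot>\<^sub>m 1\<^sub>m n) \<and>
    (\<exists>B. finite B \<and> B \<subseteq> carrier A \<and>
      (\<forall>a \<in> carrier A. \<exists>!u. u \<in> extensional B \<and>
         a = (\<Oplus>\<^bsub>A\<^esub>b \<in> B. \<sigma> (u b) \<otimes>\<^bsub>A\<^esub> b)) \<and>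
      (\<forall>M \<in> carrier_mat n n. \<exists>!u. u \<in> extensional B \<and>
         (\<forall>i<n. \<forall>j<n. M $$ (i, j) = (\<Sum>b\<in>B. u b * \<phi> b $$ (i, j)))))"

text \<open>The reduced norm of a central simple algebra of degree \<open>n\<close>, as a \<open>K\<close>-valued function on \<open>A\<close>.
  It does not depend on the splitting, by the Skolem-Noether theorem.\<close>

definition is_reduced_norm ::
    "('r, 'b) ring_scheme \<Rightarrow> ('k::field \<Rightarrow> 'r) \<Rightarrow> nat \<Rightarrow> ('r \<Rightarrow> 'k) \<Rightarrow> bool"
  where "is_reduced_norm A \<sigma> n N \<longleftrightarrow>
    (\<exists>\<phi>. is_splitting A \<sigma> n \<phi> \<and> (\<forall>a \<in> carrier A. to_ac (N a) = det (\<phi> a)))"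

end

theory Submission
  imports Defs "HOL-Computational_Algebra.Polynomial_Factorial"
begin

text \<open>Write \<open>E = p\<^sup>e\<close>. The reduced norm is multiplicative, and its values on \<open>R\<close> have bounded
  denominators: \<open>R\<close> is finitely generated over \<open>F[x]\<close>, so by Leibniz' formula the norm of
  a combination of the generators is a polynomial in the coefficients. Applying this to high powers
  of \<open>f\<close> shows that \<open>N(f)\<close> lies in \<open>F[x]\<close>, and together with Frobenius that \<open>N(f)\<close> is monic of
  degree \<open>d m\<close> for monic \<open>f\<close> of degree \<open>m\<close>.

  An irreducible \<open>f\<close> has an irreducible minimal central multiple, which divides \<open>N(f)\<close>; by induction
  \<open>N(f)\<close> is a central multiple of every \<open>f\<close> that has a nonzero one. Hence the degree hypothesis says
  that \<open>N(f)\<close> is the minimal central multiple. In that case, for a monic irreducible factor \<open>q\<close> of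
  \<open>N(f)\<close> the greatest common right divisor of \<open>f\<close> and \<open>q(x)\<close> is the unique monic right factor of
  \<open>f\<close> with norm \<open>q\<close>, and its cofactor again has its norm as minimal central multiple. So
  decompositions of \<open>f\<close> correspond to orderings of the factors of \<open>N(f)\<close>.\<close>

hide_const (open) Polynomials.degree UnivPoly.coeff

subsection \<open>Skew polynomials\<close>

text \<open>The norm is known only as the determinant of an arbitrary splitting over the algebraic
  closure of \<open>F(x)\<close>, whose matrix entries on \<open>R\<close> need not be integral over
  \<open>F[x]\<close>. Both facts about \<open>N(f)\<close> are therefore obtained from growth: a
  denominator common to all powers must be trivial, and a high power makes a bounded error in the
  degree negligible. The degree count is fixed by the central elements: \<open>x\<close> has degree
  \<open>E\<close> in \<open>t\<close> and norm \<open>x ^ (E * d)\<close>, so one degree in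
  \<open>t\<close> is worth \<open>d\<close> degrees in \<open>x\<close>. This is the
  \<open>d\<close> in the hypothesis on \<open>hhat\<close> and in the relation between the degrees
  of a factor and of its norm. The central multiples of \<open>f\<close> form an ideal of
  \<open>F[x]\<close> generated by \<open>hhat\<close>, and \<open>N(f)\<close> may be a proper
  multiple of \<open>hhat\<close>. Equality is what guarantees a right factor for each irreducible
  factor of the norm, in any order. Distinctness matters in (ii) because the norm of an irreducible
  element is a priori only a power of an irreducible polynomial, up to a unit; a squarefree
  \<open>N(f)\<close> forces exponent one, so that no decomposition escapes the count.\<close>

locale skew_polynomials =
  fixes \<delta> :: "'a::division_ring \<Rightarrow> 'a"
  assumes derivation: "is_derivation \<delta>"
begin

definition smul :: "'a \<Rightarrow> 'a poly \<Rightarrow> 'a poly"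
  where "smul a = map_poly (\<lambda>b. a * b)"

abbreviation skew_times (infixl "\<star>" 70)
  where "f \<star> q \<equiv> skew_mult \<delta> f q"

abbreviation R :: "'a poly ring"
  where "R \<equiv> skew_ring \<delta>"

lemma der_add: "\<delta> (a + b) = \<delta> a + \<delta> b"
  and der_mult: "\<delta> (a * b) = a * \<delta> b + \<delta> a * b"
  using derivation by (auto simp: is_derivation_def)

lemma der_0 [simp]: "\<delta> 0 = 0"
  using der_add[of 0 0] by simp

lemma der_1 [simp]: "\<delta> 1 = 0"
  using der_mult[of 1 1] by simp

lemma der_sum: "\<delta> (\<Sum>i\<in>A. u i) = (\<Sum>i\<in>A. \<delta> (u i))"
  by (induction A rule: infinite_finite_induct) (auto simp: der_add)

lemma coeff_smul [simp]: "coeff (smul a q) k = a * coeff q k"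
  by (simp add: smul_def coeff_map_poly)

lemma skew_mult_eq: "f \<star> q = (\<Sum>i\<le>degree f. smul (coeff f i) ((t_mult \<delta> ^^ i) q))"
  by (simp add: skew_mult_def smul_def)

lemma coeff_t_mult: "coeff (t_mult \<delta> q) k = (case k of 0 \<Rightarrow> 0 | Suc j \<Rightarrow> coeff q j) + \<delta> (coeff q k)"
  by (simp add: t_mult_def coeff_map_poly coeff_pCons)

lemma smul_0_right [simp]: "smul a 0 = 0"
  by (rule poly_eqI) simp

lemma smul_monom: "smul a (monom b n) = monom (a * b) n"
  by (rule poly_eqI) simp

lemma smul_add: "smul a (q + r) = smul a q + smul a r"
  by (rule poly_eqI) (simp add: algebra_simps)

lemma smul_add_left: "smul (a + b) q = smul a q + smul b q"
  by (rule poly_eqI) (simp add: algebra_simps)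

lemma smul_0_left [simp]: "smul 0 q = 0"
  by (rule poly_eqI) simp

lemma smul_1_left [simp]: "smul 1 q = q"
  by (rule poly_eqI) simp

lemma smul_smul: "smul a (smul b q) = smul (a * b) q"
  by (rule poly_eqI) (simp add: algebra_simps)

lemma smul_sum: "smul a (\<Sum>i\<in>A. u i) = (\<Sum>i\<in>A. smul a (u i))"
  by (induction A rule: infinite_finite_induct) (auto simp: smul_add)

lemma t_mult_add: "t_mult \<delta> (q + r) = t_mult \<delta> q + t_mult \<delta> r"
  by (rule poly_eqI) (simp add: coeff_t_mult der_add algebra_simps split: nat.splits)

lemma t_mult_0 [simp]: "t_mult \<delta> 0 = 0"
  by (simp add: t_mult_def)

lemma t_mult_sum: "t_mult \<delta> (\<Sum>i\<in>A. u i) = (\<Sum>i\<in>A. t_mult \<delta> (u i))"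
  by (induction A rule: infinite_finite_induct) (auto simp: t_mult_add)

lemma t_mult_smul: "t_mult \<delta> (smul a q) = smul a (t_mult \<delta> q) + smul (\<delta> a) q"
  by (rule poly_eqI) (simp add: coeff_t_mult der_mult algebra_simps split: nat.splits)

lemma t_mult_pow_add: "(t_mult \<delta> ^^ i) (q + r) = (t_mult \<delta> ^^ i) q + (t_mult \<delta> ^^ i) r"
  by (induction i) (auto simp: t_mult_add)

lemma t_mult_pow_0 [simp]: "(t_mult \<delta> ^^ i) 0 = 0"
  by (induction i) auto

text \<open>The degree is a poor summation bound, since it drops under cancellation. A larger bound
  only adds zero terms, so the sums for several left factors can be taken over one range.\<close>

lemma skew_mult_bound:
  assumes "\<And>i. i > n \<Longrightarrow> coeff f i = 0"
  shows "f \<star> q = (\<Sum>i\<le>n. smul (coeff f i) ((t_mult \<delta> ^^ i) q))"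
  unfolding skew_mult_eq
proof (rule sum.mono_neutral_cong)
  fix i assume "i \<in> {..n} - {..Polynomial.degree f}"
  then show "smul (coeff f i) ((t_mult \<delta> ^^ i) q) = 0"
    by (simp add: coeff_eq_0)
next
  fix i assume "i \<in> {..Polynomial.degree f} - {..n}"
  then show "smul (coeff f i) ((t_mult \<delta> ^^ i) q) = 0"
    using assms by simp
qed auto

lemma skew_add_left: "(f + g) \<star> q = f \<star> q + g \<star> q"
proof -
  let ?n = "max (degree f) (degree g)"
  have "(f + g) \<star> q = (\<Sum>i\<le>?n. smul (coeff (f + g) i) ((t_mult \<delta> ^^ i) q))"
    by (rule skew_mult_bound) (auto simp: coeff_eq_0)
  moreover have "f \<star> q = (\<Sum>i\<le>?n. smul (coeff f i) ((t_mult \<delta> ^^ i) q))"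
    by (rule skew_mult_bound) (auto simp: coeff_eq_0)
  moreover have "g \<star> q = (\<Sum>i\<le>?n. smul (coeff g i) ((t_mult \<delta> ^^ i) q))"
    by (rule skew_mult_bound) (auto simp: coeff_eq_0)
  ultimately show ?thesis
    by (simp add: smul_add_left sum.distrib)
qed

lemma skew_add_right: "f \<star> (q + r) = f \<star> q + f \<star> r"
  by (simp add: skew_mult_eq t_mult_pow_add smul_add sum.distrib)

lemma skew_0_left [simp]: "0 \<star> q = 0"
  by (simp add: skew_mult_eq)

lemma skew_0_right [simp]: "f \<star> 0 = 0"
  by (simp add: skew_mult_eq)

lemma skew_minus_left: "(- f) \<star> q = - (f \<star> q)"
  using skew_add_left[of f "- f" q] by (simp add: eq_neg_iff_add_eq_0 add.commute)

lemma skew_minus_right: "f \<star> (- q) = - (f \<star> q)"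
  using skew_add_right[of f q "- q"] by (simp add: eq_neg_iff_add_eq_0 add.commute)

lemma skew_diff_left: "(f - g) \<star> q = f \<star> q - g \<star> q"
  using skew_add_left[of f "- g" q] by (simp add: skew_minus_left)

lemma skew_diff_right: "f \<star> (q - r) = f \<star> q - f \<star> r"
  using skew_add_right[of f q "- r"] by (simp add: skew_minus_right)

lemma skew_sum_left: "(\<Sum>i\<in>A. u i) \<star> q = (\<Sum>i\<in>A. u i \<star> q)"
  by (induction A rule: infinite_finite_induct) (auto simp: skew_add_left)

lemma skew_sum_right: "f \<star> (\<Sum>i\<in>A. u i) = (\<Sum>i\<in>A. f \<star> u i)"
  by (induction A rule: infinite_finite_induct) (auto simp: skew_add_right)

lemma skew_const_left: "[:a:] \<star> q = smul a q"
  by (simp add: skew_mult_eq)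

lemma skew_smul_left: "smul a f \<star> q = smul a (f \<star> q)"
proof -
  have "smul a f \<star> q = (\<Sum>i\<le>degree f. smul (coeff (smul a f) i) ((t_mult \<delta> ^^ i) q))"
    by (rule skew_mult_bound) (auto simp: coeff_eq_0)
  then show ?thesis
    by (simp add: skew_mult_eq smul_sum smul_smul)
qed

lemma skew_t_left: "[:0, 1:] \<star> q = t_mult \<delta> q"
  by (simp add: skew_mult_eq)

text \<open>Associativity for a left factor \<open>t f\<close>. The shift and the
  \<open>\<delta>\<close>-part of \<open>t f\<close> produce exactly the two summands that the
  product rule gives when \<open>t\<close> passes the coefficients of \<open>f\<close>.\<close>

lemma skew_t_mult_left: "t_mult \<delta> f \<star> q = t_mult \<delta> (f \<star> q)"
proof -
  let ?n = "degree f" and ?T = "t_mult \<delta>"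
  have "pCons 0 f \<star> q = (\<Sum>i\<le>Suc ?n. smul (coeff (pCons 0 f) i) ((?T ^^ i) q))"
    by (rule skew_mult_bound) (auto simp: coeff_eq_0 coeff_pCons split: nat.splits)
  also have "\<dots> = (\<Sum>i\<le>?n. smul (coeff f i) (?T ((?T ^^ i) q)))"
    by (subst sum.atMost_Suc_shift) simp
  finally have 1: "pCons 0 f \<star> q = (\<Sum>i\<le>?n. smul (coeff f i) (?T ((?T ^^ i) q)))" .
  have 2: "map_poly \<delta> f \<star> q = (\<Sum>i\<le>?n. smul (\<delta> (coeff f i)) ((?T ^^ i) q))"
    using skew_mult_bound[of ?n "map_poly \<delta> f" q] by (simp add: coeff_map_poly coeff_eq_0)
  show ?thesis
    unfolding t_mult_def[of \<delta> f] skew_add_left 1 2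
    by (simp add: skew_mult_eq t_mult_sum t_mult_smul sum.distrib)
qed

lemma skew_t_mult_pow_left: "(t_mult \<delta> ^^ i) f \<star> q = (t_mult \<delta> ^^ i) (f \<star> q)"
  by (induction i) (auto simp: skew_t_mult_left)

text \<open>By additivity and left \<open>D\<close>-linearity, only powers of \<open>t\<close> on
  the left matter.\<close>

lemma skew_assoc: "(f \<star> g) \<star> q = f \<star> (g \<star> q)"
  by (simp add: skew_mult_eq[of f] skew_sum_left skew_smul_left skew_t_mult_pow_left)

lemma t_mult_pow_1: "(t_mult \<delta> ^^ i) [:1:] = monom 1 i"
  by (induction i) (auto simp: t_mult_def monom_Suc map_poly_monom monom_0[symmetric])

lemma skew_1_left [simp]: "[:1:] \<star> q = q"
  by (simp add: skew_const_left)

lemma skew_1_right [simp]: "f \<star> [:1:] = f"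
proof -
  have "f \<star> [:1:] = (\<Sum>i\<le>degree f. monom (coeff f i) i)"
    by (simp add: skew_mult_eq t_mult_pow_1 smul_monom)
  then show ?thesis
    by (simp add: poly_as_sum_of_monoms)
qed

lemma carrier_R [simp]: "carrier R = UNIV"
  and mult_R [simp]: "f \<otimes>\<^bsub>R\<^esub> g = f \<star> g"
  and add_R [simp]: "f \<oplus>\<^bsub>R\<^esub> g = f + g"
  and one_R [simp]: "\<one>\<^bsub>R\<^esub> = [:1:]"
  and zero_R [simp]: "\<zero>\<^bsub>R\<^esub> = 0"
  by (simp_all add: skew_ring_def)

sublocale R: ring R
proof (rule ringI)
  show "abelian_group R"
    by (rule abelian_groupI) (auto simp: algebra_simps intro: exI[of _ "- _"])
  show "monoid R"
    by (rule monoidI) (auto simp: skew_assoc)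
qed (auto simp: skew_add_left skew_add_right)

section \<open>Degrees and leading coefficients\<close>

lemma t_mult_bound:
  assumes "\<And>k. k > n \<Longrightarrow> coeff q k = 0"
  shows "k > Suc n \<Longrightarrow> coeff (t_mult \<delta> q) k = 0"
    and "coeff (t_mult \<delta> q) (Suc n) = coeff q n"
  using assms by (auto simp: coeff_t_mult split: nat.splits)

lemma t_mult_pow_bound:
  assumes "\<And>k. k > n \<Longrightarrow> coeff q k = 0"
  shows "(\<forall>k > n + i. coeff ((t_mult \<delta> ^^ i) q) k = 0) \<and>
    coeff ((t_mult \<delta> ^^ i) q) (n + i) = coeff q n"
proof (induction i)
  case (Suc i)
  then show ?case
    using t_mult_bound[of "n + i" "(t_mult \<delta> ^^ i) q"] by auto
qed (use assms in auto)

text \<open>The corrections in \<open>t b = b t + \<delta>(b)\<close> lower the degree, so top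
  coefficients multiply as for ordinary polynomials. Bounds \<open>n\<close>, \<open>m\<close>
  instead of degrees allow the coefficients in question to be zero.\<close>

lemma coeff_skew_top:
  assumes "\<And>k. k > n \<Longrightarrow> coeff f k = 0" "\<And>k. k > m \<Longrightarrow> coeff g k = 0"
  shows "k > n + m \<Longrightarrow> coeff (f \<star> g) k = 0"
    and "coeff (f \<star> g) (n + m) = coeff f n * coeff g m"
proof -
  have T: "(\<forall>k > m + i. coeff ((t_mult \<delta> ^^ i) g) k = 0) \<and>
      coeff ((t_mult \<delta> ^^ i) g) (m + i) = coeff g m" for i
    using assms(2) by (rule t_mult_pow_bound)
  have f: "f \<star> g = (\<Sum>i\<le>n. smul (coeff f i) ((t_mult \<delta> ^^ i) g))"
    using assms(1) by (rule skew_mult_bound)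
  show "coeff (f \<star> g) k = 0" if "k > n + m"
    unfolding f coeff_sum
  proof (rule sum.neutral, rule ballI)
    fix i assume "i \<in> {..n}"
    then have "k > m + i"
      using that by auto
    then show "coeff (smul (coeff f i) ((t_mult \<delta> ^^ i) g)) k = 0"
      using T[of i] by simp
  qed
  have "coeff (f \<star> g) (n + m) = (\<Sum>i\<le>n. if i = n then coeff f n * coeff g m else 0)"
    unfolding f coeff_sum
  proof (rule sum.cong)
    fix i assume "i \<in> {..n}"
    then have "i = n \<or> n + m > m + i"
      by auto
    then show "coeff (smul (coeff f i) ((t_mult \<delta> ^^ i) g)) (n + m) =
        (if i = n then coeff f n * coeff g m else 0)"
      using T[of i] by (auto simp: add.commute)
  qed simp
  then show "coeff (f \<star> g) (n + m) = coeff f n * coeff g m"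
    by simp
qed

lemma degree_skew_le: "degree (f \<star> g) \<le> degree f + degree g"
  by (rule degree_le) (use coeff_skew_top(1)[of "degree f" f "degree g" g] in \<open>auto simp: coeff_eq_0\<close>)

lemma coeff_skew_lead: "coeff (f \<star> g) (degree f + degree g) = lead_coeff f * lead_coeff g"
  by (rule coeff_skew_top) (auto simp: coeff_eq_0)

lemma skew_eq_0_iff [simp]: "f \<star> g = 0 \<longleftrightarrow> f = 0 \<or> g = 0"
  using coeff_skew_lead[of f g] by (metis coeff_0 leading_coeff_0_iff mult_eq_0_iff skew_0_left skew_0_right)

lemma degree_skew: "f \<noteq> 0 \<Longrightarrow> g \<noteq> 0 \<Longrightarrow> degree (f \<star> g) = degree f + degree g"
  by (metis coeff_skew_lead degree_skew_le le_antisym le_degree leading_coeff_0_iff mult_eq_0_iff)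

lemma lead_coeff_skew: "lead_coeff (f \<star> g) = lead_coeff f * lead_coeff g"
  by (cases "f = 0 \<or> g = 0") (auto simp: degree_skew coeff_skew_lead)

lemma skew_cancel_right: "f \<star> q = g \<star> q \<Longrightarrow> q \<noteq> 0 \<Longrightarrow> f = g"
  using skew_eq_0_iff[of "f - g" q] by (auto simp: skew_diff_left)

lemma skew_cancel_left: "q \<star> f = q \<star> g \<Longrightarrow> q \<noteq> 0 \<Longrightarrow> f = g"
  using skew_eq_0_iff[of q "f - g"] by (auto simp: skew_diff_right)

section \<open>Right division and greatest common right divisors\<close>

lemma skew_right_division:
  assumes "g \<noteq> 0"
  shows "\<exists>q r. f = q \<star> g + r \<and> (r = 0 \<or> degree r < degree g)"
proof (induction "degree f" arbitrary: f rule: less_induct)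
  case less
  show ?case
  proof (cases "f = 0 \<or> degree f < degree g")
    case True
    then show ?thesis
      by (intro exI[of _ 0] exI[of _ f]) auto
  next
    case False
    \<comment> \<open>In the leading coefficient of \<open>s \<star> g\<close> that of
      \<open>g\<close> stands on the right, hence its inverse is put to the right of
      \<open>lead_coeff f\<close>.\<close>
    define s where "s = monom (lead_coeff f * inverse (lead_coeff g)) (degree f - degree g)"
    have s: "s \<noteq> 0" "degree s = degree f - degree g" "lead_coeff s = lead_coeff f * inverse (lead_coeff g)"
      using False assms by (auto simp: s_def degree_monom_eq)
    have "lead_coeff (s \<star> g) = lead_coeff f"
      unfolding lead_coeff_skew s(3) using assms by (simp add: mult.assoc)
    moreover have "degree (s \<star> g) = degree f"
      using s assms False by (simp add: degree_skew)
    ultimately have "lead_coeff (s \<star> g) = lead_coeff f" "degree (s \<star> g) = degree f"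
      by auto
    then have "coeff (f - s \<star> g) (degree f) = 0" "degree (f - s \<star> g) \<le> degree f"
      by (auto intro: degree_diff_le)
    then have "f - s \<star> g = 0 \<or> degree (f - s \<star> g) < degree f"
      by (metis leading_coeff_0_iff le_neq_implies_less)
    then obtain q r where "f - s \<star> g = q \<star> g + r" "r = 0 \<or> degree r < degree g"
      using less(1)[of "f - s \<star> g"] by (metis add_0 skew_0_left)
    then show ?thesis
      by (intro exI[of _ "s + q"] exI[of _ r]) (auto simp: skew_add_left algebra_simps)
  qed
qed

text \<open>Left ideals of \<open>R\<close> are principal by right division: a nonzero element of
  least degree in \<open>R f + R k\<close>, scaled to be monic, generates it. Later arguments
  multiply the Bezout identity by central elements.\<close>

lemma skew_gcrd:
  assumes "f \<noteq> 0"
  obtains g a b u v where "lead_coeff g = 1" "g = a \<star> f + b \<star> k" "f = u \<star> g" "k = v \<star> g"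
proof -
  define I where "I = {a \<star> f + b \<star> k |a b. True}"
  have "f \<in> I"
    unfolding I_def by clarify (metis add.right_neutral skew_0_left skew_1_left)
  then obtain g0 where g0: "g0 \<in> I" "g0 \<noteq> 0" "\<And>y. y \<in> I \<Longrightarrow> y \<noteq> 0 \<Longrightarrow> degree g0 \<le> degree y"
    using ex_has_least_nat[of "\<lambda>y. y \<in> I \<and> y \<noteq> 0" f degree] assms by blast
  define g where "g = [:inverse (lead_coeff g0):] \<star> g0"
  have lc: "lead_coeff g = 1"
    using g0(2) by (simp add: g_def lead_coeff_skew del: mult_pCons_left)
  then have "g \<noteq> 0"
    by auto
  have deg: "degree g = degree g0"
    using g0(2) by (simp add: g_def degree_skew)
  have sub: "y - q \<star> z \<in> I" if yz: "y \<in> I" "z \<in> I" for y q z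
  proof -
    obtain a b a' b' where ab: "y = a \<star> f + b \<star> k" "z = a' \<star> f + b' \<star> k"
      using yz unfolding I_def by blast
    have "y - q \<star> z = (a - q \<star> a') \<star> f + (b - q \<star> b') \<star> k"
      unfolding ab by (simp add: skew_diff_left skew_assoc skew_add_right)
    then show ?thesis
      unfolding I_def by blast
  qed
  have "0 \<in> I"
    unfolding I_def by clarify (metis add.right_neutral skew_0_left)
  have gI: "g \<in> I"
    using sub[OF \<open>0 \<in> I\<close> g0(1), of "- [:inverse (lead_coeff g0):]"]
    unfolding g_def skew_minus_left by simp
  have div: "\<exists>q. y = q \<star> g" if y: "y \<in> I" for y
  proof -
    obtain q r where qr: "y = q \<star> g + r" "r = 0 \<or> degree r < degree g"
      using skew_right_division[OF \<open>g \<noteq> 0\<close>] by blast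
    have "r = y - q \<star> g"
      using qr by simp
    then have "r \<in> I"
      using sub[OF y gI] by simp
    then have "r = 0"
      using qr(2) g0(3)[of r] deg by force
    then show ?thesis
      using qr by auto
  qed
  have "k \<in> I"
    unfolding I_def by clarify (metis add_0 skew_0_left skew_1_left)
  then show thesis
    using that[OF lc] div \<open>f \<in> I\<close> gI unfolding I_def by blast
qed

section \<open>Powers, and how powers of \<open>t\<close> commute with constants\<close>

abbreviation skew_power (infixr "\<up>" 80)
  where "f \<up> n \<equiv> f [^]\<^bsub>R\<^esub> (n::nat)"

lemma skew_power_0 [simp]: "f \<up> 0 = [:1:]"
  by simp

lemma skew_power_Suc: "f \<up> Suc n = f \<up> n \<star> f"
  by simp

lemma skew_power_Suc2: "f \<up> Suc n = f \<star> f \<up> n"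
  using R.nat_pow_Suc2[of f n] by simp

lemma skew_power_mult: "f \<up> (n * m) = (f \<up> n) \<up> m"
  using R.nat_pow_pow[of f n m] by simp

lemma skew_power_eq_0 [simp]: "f \<up> n = 0 \<longleftrightarrow> f = 0 \<and> n > 0"
  by (induction n) (auto simp: skew_power_Suc simp del: R.nat_pow_Suc)

lemma degree_skew_power: "degree (f \<up> n) = n * degree f"
proof (cases "f = 0")
  case True
  then show ?thesis
    by (cases n) simp_all
next
  case False
  then show ?thesis
    by (induction n) (simp_all add: degree_skew)
qed

lemma lead_coeff_skew_power: "lead_coeff f = 1 \<Longrightarrow> lead_coeff (f \<up> n) = 1"
  by (induction n) (simp_all add: lead_coeff_skew)

lemma t_power: "[:0, 1:] \<up> n = monom 1 n"
proof (induction n)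
  case (Suc n)
  have "[:0, 1:] \<up> Suc n = t_mult \<delta> (monom 1 n)"
    unfolding skew_power_Suc2 Suc skew_t_left ..
  then show ?case
    by (simp add: t_mult_def monom_Suc map_poly_monom)
qed (simp add: monom_0)

lemma skew_t_right: "q \<star> [:0, 1:] = pCons 0 q"
proof -
  have *: "t_mult \<delta> (monom 1 i) = monom 1 (Suc i)" for i
    by (simp add: t_mult_def monom_Suc map_poly_monom)
  have "(t_mult \<delta> ^^ i) (monom 1 1) = monom 1 (Suc i)" for i
    by (induction i) (simp_all add: *)
  moreover have "[:0, 1:] = (monom 1 1 :: 'a poly)"
    by (simp add: monom_Suc monom_0)
  ultimately have "q \<star> [:0, 1:] = (\<Sum>i\<le>degree q. smul (coeff q i) (monom 1 (Suc i)))"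
    by (simp add: skew_mult_eq)
  also have "\<dots> = pCons 0 (\<Sum>i\<le>degree q. monom (coeff q i) i)"
    by (rule poly_eqI) (simp add: smul_monom coeff_sum coeff_pCons split: nat.splits)
  finally show ?thesis
    by (simp add: poly_as_sum_of_monoms)
qed

text \<open>\<open>D\<close> and \<open>t\<close> generate \<open>R\<close>; multiplying by
  \<open>t\<close> on the right leaves the coefficients untouched, which makes induction over
  \<open>pCons\<close> fit.\<close>

lemma centralI:
  assumes "\<And>a. x \<star> [:a:] = [:a:] \<star> x" and "x \<star> [:0, 1:] = [:0, 1:] \<star> x"
  shows "x \<star> y = y \<star> x"
proof (induction y)
  case (pCons a q)
  have *: "pCons a q = [:a:] + q \<star> [:0, 1:]"
    by (simp add: skew_t_right)
  have "x \<star> (q \<star> [:0, 1:]) = (q \<star> [:0, 1:]) \<star> x"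
    by (simp only: skew_assoc[symmetric] pCons.IH) (simp only: skew_assoc assms(2))
  then show ?case
    unfolding * skew_add_left skew_add_right assms(1) by simp
qed simp

lemma skew_const_const: "[:a:] \<star> [:b:] = [:a * b:]"
  by (simp add: skew_const_left smul_def map_poly_pCons)

text \<open>Leibniz' formula for the commutator with \<open>y\<close>, which maps \<open>D\<close>
  to \<open>D\<close> by assumption. A general \<open>y\<close> is needed because the formula is
  iterated with powers of \<open>t\<close> in place of \<open>t\<close>.\<close>

lemma skew_power_const_binomial:
  assumes comm: "\<And>a. y \<star> [:a:] = [:a:] \<star> y + [:\<gamma> a:]"
  shows "y \<up> n \<star> [:a:] = (\<Sum>j\<le>n. smul (of_nat (n choose j) * (\<gamma> ^^ j) a) (y \<up> (n - j)))"
proof (induction n)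
  case (Suc n)
  \<comment> \<open>Additivity of \<open>\<gamma>\<close> is read off from \<open>comm\<close>,
    since \<open>\<gamma> a\<close> is the commutator of \<open>y\<close> with the constant
    \<open>a\<close>.\<close>
  have \<gamma>_add: "\<gamma> (a + b) = \<gamma> a + \<gamma> b" for a b
  proof -
    have "[:\<gamma> (a + b):] = y \<star> ([:a:] + [:b:]) - ([:a:] + [:b:]) \<star> y"
      using comm[of "a + b"] by simp
    also have "\<dots> = [:\<gamma> a:] + [:\<gamma> b:]"
      unfolding skew_add_left skew_add_right comm by simp
    finally show ?thesis by simp
  qed
  have \<gamma>_0: "\<gamma> 0 = 0"
    using \<gamma>_add[of 0 0] by simp
  have \<gamma>_nat: "\<gamma> (of_nat k * b) = of_nat k * \<gamma> b" for k b
    by (induction k) (simp_all add: \<gamma>_0 \<gamma>_add algebra_simps)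
  let ?g = "\<lambda>j. (\<gamma> ^^ j) a"
  \<comment> \<open>\<open>u k j\<close> is \<open>k\<close> times the \<open>j\<close>-th term for
    exponent \<open>Suc n\<close>; its additivity in \<open>k\<close> reduces the recombination to
    Pascal's rule.\<close>
  define u where "u k j = smul (of_nat k * ?g j) (y \<up> (Suc n - j))" for k j
  have u_add: "u (k + l) j = u k j + u l j" for k l j
    by (simp add: u_def smul_add_left algebra_simps)
  have "y \<up> Suc n \<star> [:a:] = (\<Sum>j\<le>n. y \<star> smul (of_nat (n choose j) * ?g j) (y \<up> (n - j)))"
    by (simp only: skew_power_Suc2 skew_assoc Suc skew_sum_right)
  also have "\<dots> = (\<Sum>j\<le>n. u (n choose j) j + u (n choose j) (Suc j))"
  proof (rule sum.cong)
    fix j assume j: "j \<in> {..n}"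
    have "y \<star> smul (of_nat (n choose j) * ?g j) (y \<up> (n - j)) =
        (y \<star> [:of_nat (n choose j) * ?g j:]) \<star> y \<up> (n - j)"
      by (simp add: skew_const_left skew_assoc)
    also have "\<dots> = smul (of_nat (n choose j) * ?g j) (y \<star> y \<up> (n - j)) +
        smul (of_nat (n choose j) * ?g (Suc j)) (y \<up> (n - j))"
      by (simp add: comm skew_add_left skew_const_left skew_smul_left \<gamma>_nat)
    finally show "y \<star> smul (of_nat (n choose j) * ?g j) (y \<up> (n - j)) =
        u (n choose j) j + u (n choose j) (Suc j)"
      using j by (simp only: u_def skew_power_Suc2[symmetric] diff_Suc_Suc Suc_diff_le atMost_iff)
  qed simp
  also have "\<dots> = (\<Sum>j\<le>n. u (n choose j) j) + (\<Sum>j\<le>n. u (n choose j) (Suc j))"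
    by (rule sum.distrib)
  also have "(\<Sum>j\<le>n. u (n choose j) j) = (\<Sum>j\<le>Suc n. u (n choose j) j)"
    by (simp add: u_def binomial_eq_0)
  also have "\<dots> = u 1 0 + (\<Sum>j\<le>n. u (n choose Suc j) (Suc j))"
    by (subst sum.atMost_Suc_shift) simp
  also have "\<dots> + (\<Sum>j\<le>n. u (n choose j) (Suc j)) =
      u 1 0 + (\<Sum>j\<le>n. u (Suc n choose Suc j) (Suc j))"
    by (simp add: u_add sum.distrib add.assoc add.commute)
  also have "\<dots> = (\<Sum>j\<le>Suc n. u (Suc n choose j) j)"
    by (simp only: sum.atMost_Suc_shift binomial_n_0)
  finally show ?case
    by (simp add: u_def)
qed (simp add: skew_const_left skew_const_const smul_def map_poly_pCons)

text \<open>In characteristic \<open>p\<close> only the two outer terms survive, so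
  \<open>y \<up> p\<close> satisfies a relation of the same shape with \<open>\<gamma> ^^ p\<close>.
  This is what permits iteration.\<close>

lemma skew_power_const_prime:
  assumes comm: "\<And>a. y \<star> [:a:] = [:a:] \<star> y + [:\<gamma> a:]"
    and p: "prime p" "CHAR('a) = p"
  shows "y \<up> p \<star> [:a:] = [:a:] \<star> y \<up> p + [:(\<gamma> ^^ p) a:]"
proof -
  have "of_nat (p choose j) = (0 :: 'a)" if "j \<in> {..p} - {0, p}" for j
  proof -
    have "p dvd (p choose j)"
      using that p by (intro dvd_choose_prime) auto
    then show ?thesis
      using p by (simp add: of_nat_eq_0_iff_char_dvd)
  qed
  then have "y \<up> p \<star> [:a:] = (\<Sum>j\<in>{0, p}. smul (of_nat (p choose j) * (\<gamma> ^^ j) a) (y \<up> (p - j)))"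
    unfolding skew_power_const_binomial[OF comm] by (intro sum.mono_neutral_right) auto
  moreover have "p \<noteq> 0"
    using p by auto
  ultimately show ?thesis
    by (simp add: skew_const_left smul_def map_poly_pCons)
qed

lemma t_power_const:
  assumes "prime p" "CHAR('a) = p"
  shows "[:0, 1:] \<up> (p ^ k) \<star> [:a:] = [:a:] \<star> [:0, 1:] \<up> (p ^ k) + [:(\<delta> ^^ (p ^ k)) a:]"
proof (induction k arbitrary: a)
  case 0
  show ?case
    using skew_t_right[of "[:a:]"]
    by (simp add: skew_t_left t_mult_def map_poly_pCons)
next
  case (Suc k)
  show ?case
    using skew_power_const_prime[OF Suc assms, of a]
    by (simp add: mult.commute[of p] skew_power_mult flip: funpow_mult)
qed

section \<open>Evaluation of polynomials with central coefficients\<close>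

definition central_hom :: "('s::comm_ring_1 \<Rightarrow> 'a poly) \<Rightarrow> bool"
  where "central_hom \<eta> \<longleftrightarrow> (\<forall>a b. \<eta> (a + b) = \<eta> a + \<eta> b) \<and> (\<forall>a b. \<eta> (a * b) = \<eta> a \<star> \<eta> b) \<and>
    \<eta> 1 = [:1:] \<and> (\<forall>a y. \<eta> a \<star> y = y \<star> \<eta> a)"

text \<open>\<open>z\<close> need not be central; evaluation is multiplicative because the values of
  \<open>\<eta>\<close> are. With the embedding of \<open>F\<close> and \<open>z = x\<close> this
  gives \<open>\<kappa>\<close>; with \<open>\<eta> = \<kappa>\<close> it carries Frobenius over to
  \<open>R\<close>.\<close>

definition peval :: "('s::comm_ring_1 \<Rightarrow> 'a poly) \<Rightarrow> 'a poly \<Rightarrow> 's poly \<Rightarrow> 'a poly"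
  where "peval \<eta> z P = (\<Sum>i\<le>degree P. \<eta> (coeff P i) \<star> z \<up> i)"

context
  fixes \<eta> :: "'s::comm_ring_1 \<Rightarrow> 'a poly"
  assumes \<eta>: "central_hom \<eta>"
begin

lemma central_hom_add: "\<eta> (a + b) = \<eta> a + \<eta> b"
  and central_hom_mult: "\<eta> (a * b) = \<eta> a \<star> \<eta> b"
  and central_hom_1: "\<eta> 1 = [:1:]"
  and central_hom_comm: "\<eta> a \<star> y = y \<star> \<eta> a"
  using \<eta> unfolding central_hom_def by blast+

lemma central_hom_0: "\<eta> 0 = 0"
  using central_hom_add[of 0 0] by simp

lemma central_hom_diff: "\<eta> (a - b) = \<eta> a - \<eta> b"
  using central_hom_add[of "a - b" b] by simp

lemma central_hom_power: "\<eta> (a ^ n) = \<eta> a \<up> n"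
  by (induction n) (simp_all add: central_hom_1 central_hom_mult central_hom_comm[of a])

lemma peval_bound:
  assumes "\<And>i. i > n \<Longrightarrow> coeff P i = 0"
  shows "peval \<eta> z P = (\<Sum>i\<le>n. \<eta> (coeff P i) \<star> z \<up> i)"
  unfolding peval_def
  by (rule sum.mono_neutral_cong) (auto simp: central_hom_0 assms coeff_eq_0)

lemma peval_add: "peval \<eta> z (P + Q) = peval \<eta> z P + peval \<eta> z Q"
proof -
  let ?n = "max (degree P) (degree Q)"
  have *: "peval \<eta> z S = (\<Sum>i\<le>?n. \<eta> (coeff S i) \<star> z \<up> i)" if "S \<in> {P, Q, P + Q}" for S
    by (rule peval_bound) (use that in \<open>auto simp: coeff_eq_0\<close>)
  show ?thesis
    by (simp add: * central_hom_add skew_add_left sum.distrib)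
qed

lemma peval_const: "peval \<eta> z [:a:] = \<eta> a"
  by (simp add: peval_def)

lemma peval_pCons: "peval \<eta> z (pCons a P) = \<eta> a + z \<star> peval \<eta> z P"
proof -
  have "peval \<eta> z (pCons a P) = (\<Sum>i\<le>Suc (degree P). \<eta> (coeff (pCons a P) i) \<star> z \<up> i)"
    by (rule peval_bound) (auto simp: coeff_pCons coeff_eq_0 split: nat.splits)
  also have "\<dots> = \<eta> a + (\<Sum>i\<le>degree P. \<eta> (coeff P i) \<star> z \<up> Suc i)"
    by (subst sum.atMost_Suc_shift) simp
  also have "(\<Sum>i\<le>degree P. \<eta> (coeff P i) \<star> z \<up> Suc i) = z \<star> peval \<eta> z P"
    unfolding peval_def skew_sum_right skew_power_Suc2
    by (rule sum.cong) (simp_all add: central_hom_comm[of _ z] flip: skew_assoc)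
  finally show ?thesis .
qed

lemma peval_smult: "peval \<eta> z (smult a P) = \<eta> a \<star> peval \<eta> z P"
proof (induction P)
  case (pCons b P)
  have "\<eta> a \<star> (z \<star> peval \<eta> z P) = z \<star> (\<eta> a \<star> peval \<eta> z P)"
    by (metis central_hom_comm skew_assoc)
  then show ?case
    by (simp add: peval_pCons skew_add_right central_hom_mult pCons)
qed (simp add: peval_def central_hom_0)

lemma peval_mult: "peval \<eta> z (P * Q) = peval \<eta> z P \<star> peval \<eta> z Q"
  by (induction P)
    (simp_all add: peval_pCons peval_add peval_smult skew_add_left central_hom_0 skew_assoc
       peval_def[of _ _ 0])

lemma peval_power: "peval \<eta> z (P ^ n) = peval \<eta> z P \<up> n"
  by (induction n) (simp_all add: peval_const central_hom_1 peval_mult one_pCons flip: skew_power_Suc2)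

lemma peval_comm:
  assumes "\<And>y. z \<star> y = y \<star> z"
  shows "peval \<eta> z P \<star> y = y \<star> peval \<eta> z P"
proof (induction P)
  case (pCons a P)
  have "z \<star> peval \<eta> z P \<star> y = y \<star> (z \<star> peval \<eta> z P)"
    by (simp only: skew_assoc pCons.IH) (simp only: skew_assoc[symmetric] assms[of y])
  then show ?case
    unfolding peval_pCons skew_add_left skew_add_right by (simp only: central_hom_comm[of a y])
qed (simp add: peval_def central_hom_0)

lemma central_hom_peval: "(\<And>y. z \<star> y = y \<star> z) \<Longrightarrow> central_hom (peval \<eta> z)"
  unfolding central_hom_def[of "peval \<eta> z"]
  by (intro conjI allI peval_add peval_mult peval_comm) (simp_all add: one_pCons peval_const central_hom_1)

text \<open>Frobenius for the commuting elements \<open>\<eta> w\<close> and \<open>z\<close>, computed in \<open>S[X]\<close>.\<close>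

lemma skew_freshmans_dream:
  assumes "prime p" "CHAR('s) = p"
  shows "(\<eta> w + z) \<up> (p ^ k) = \<eta> w \<up> (p ^ k) + z \<up> (p ^ k)"
proof -
  have "peval \<eta> z (([:w:] + [:0, 1:]) ^ (p ^ k)) = peval \<eta> z ([:w:] ^ (p ^ k) + [:0, 1:] ^ (p ^ k))"
    using assms freshmans_dream'[of "p ^ k" k "[:w:]" "[:0, 1:]"] by simp
  then show ?thesis
    unfolding peval_power peval_add peval_const by (simp add: peval_pCons central_hom_0 peval_def[of _ _ 0] central_hom_1 one_pCons peval_const)
qed

end

end

subsection \<open>The centre, and finiteness over it\<close>

text \<open>Gaussian elimination over a division ring with the unknowns on the left: equation
  \<open>m\<close> is solved for \<open>c j0\<close>, and substitution leaves \<open>m\<close>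
  equations in the other unknowns.\<close>

lemma nontrivial_solution:
  fixes A :: "nat \<Rightarrow> 'j \<Rightarrow> 'a::division_ring"
  assumes "finite J" "card J > m"
  shows "\<exists>c. (\<exists>j\<in>J. c j \<noteq> 0) \<and> (\<forall>i<m. (\<Sum>j\<in>J. c j * A i j) = 0)"
  using assms
proof (induction m arbitrary: J A)
  case 0
  then show ?case
    by (intro exI[of _ "\<lambda>_. 1"]) (auto simp: card_gt_0_iff)
next
  case (Suc m)
  show ?case
  proof (cases "\<forall>j\<in>J. A m j = 0")
    case True
    have "card J > m"
      using Suc.prems by simp
    from Suc.IH[OF Suc.prems(1) this, of A] show ?thesis
      using True by (auto simp: less_Suc_eq)
  next
    case False
    then obtain j0 where j0: "j0 \<in> J" "A m j0 \<noteq> 0"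
      by blast
    define r where "r j = A m j * inverse (A m j0)" for j
    let ?J = "J - {j0}"
    have "card ?J > m"
      using Suc.prems j0 by simp
    from Suc.IH[OF _ this, of "\<lambda>i j. A i j - r j * A i j0"] Suc.prems
    obtain c where c: "\<exists>j\<in>?J. c j \<noteq> 0"
      "\<And>i. i < m \<Longrightarrow> (\<Sum>j\<in>?J. c j * (A i j - r j * A i j0)) = 0"
      by auto
    define c' where "c' = c(j0 := - (\<Sum>j\<in>?J. c j * r j))"
    have split: "(\<Sum>j\<in>J. c' j * A i j) = (\<Sum>j\<in>?J. c j * (A i j - r j * A i j0))" for i
    proof -
      have "(\<Sum>j\<in>J. c' j * A i j) = c' j0 * A i j0 + (\<Sum>j\<in>?J. c' j * A i j)"
        using Suc.prems j0 by (simp add: sum.remove)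
      also have "(\<Sum>j\<in>?J. c' j * A i j) = (\<Sum>j\<in>?J. c j * A i j)"
        by (rule sum.cong) (auto simp: c'_def)
      finally show ?thesis
        by (simp add: c'_def right_diff_distrib sum_subtractf sum_distrib_right mult.assoc)
    qed
    have "(\<Sum>j\<in>J. c' j * A i j) = 0" if "i < Suc m" for i
    proof (cases "i = m")
      case True
      then show ?thesis
        unfolding split using j0 by (simp add: r_def mult.assoc)
    next
      case False
      then show ?thesis
        unfolding split using c(2) that by simp
    qed
    moreover have "\<exists>j\<in>J. c' j \<noteq> 0"
      using c(1) by (auto simp: c'_def)
    ultimately show ?thesis
      by blast
  qed
qed

locale skew_center = skew_polynomials \<delta> for \<delta> :: "'a::division_ring \<Rightarrow> 'a" +
  fixes \<iota> :: "'f::field \<Rightarrow> 'a" and p e :: nat and g :: "'f poly" and d\<^sub>0 :: 'a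
  assumes prime_p: "prime p" and char_p: "CHAR('a) = p"
    and hom_\<iota>: "Ring_Hom.ring_hom \<iota>"
    and range_\<iota>: "range \<iota> = {a. \<delta> a = 0} \<inter> {z. \<forall>y. z * y = y * z}"
    and g_supp: "\<And>i. coeff g i \<noteq> 0 \<Longrightarrow> \<exists>k. i = p ^ k"
    and degree_g: "degree g = p ^ e" and monic_g: "lead_coeff g = 1"
    and g_inner: "\<And>z. poly_in_derivation \<iota> \<delta> g z = d\<^sub>0 * z - z * d\<^sub>0"
    and der_d0: "\<delta> d\<^sub>0 = 0"
    and finite_over_center:
      "\<exists>B :: 'a set. finite B \<and> (\<forall>a. \<exists>u. (\<forall>b\<in>B. u b \<in> {z. \<forall>y. z * y = y * z}) \<and> a = (\<Sum>b\<in>B. u b * b))"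
begin

sublocale \<iota>: Ring_Hom.ring_hom \<iota>
  by (rule hom_\<iota>)

lemmas \<iota>_simps [simp] = \<iota>.hom_zero \<iota>.hom_one \<iota>.hom_add \<iota>.hom_mult \<iota>.hom_uminus

lemma \<iota>_eq_0_iff [simp]: "\<iota> c = 0 \<longleftrightarrow> c = 0"
proof
  assume "\<iota> c = 0"
  then have "\<iota> (c * inverse c) = 0"
    by (simp only: \<iota>.hom_mult) simp
  then show "c = 0"
    by (metis \<iota>.hom_one right_inverse zero_neq_one)
qed simp

lemma \<iota>_comm: "\<iota> c * y = y * \<iota> c"
  and der_\<iota> [simp]: "\<delta> (\<iota> c) = 0"
  using range_\<iota> by auto

lemma char_f: "CHAR('f) = p"
proof -
  have *: "\<iota> (of_nat k) = of_nat k" for k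
    by (induction k) simp_all
  have "of_nat k = (0 :: 'f) \<longleftrightarrow> of_nat k = (0 :: 'a)" for k
    unfolding *[symmetric] \<iota>_eq_0_iff ..
  then show ?thesis
    using char_p by (metis CHAR_eqI of_nat_CHAR of_nat_eq_0_iff_char_dvd)
qed

definition E :: nat
  where "E = p ^ e"

lemma E_pos: "E > 0"
  using prime_p by (simp add: E_def prime_gt_0_nat)

lemma degree_g_E: "degree g = E"
  by (simp add: E_def degree_g)

definition x :: "'a poly"
  where "x = map_poly \<iota> g - [:d\<^sub>0:]"

definition \<kappa> :: "'f poly \<Rightarrow> 'a poly"
  where "\<kappa> = peval (\<lambda>c. [:\<iota> c:]) x"

lemma eval_at_x: "eval_at \<iota> \<delta> x = \<kappa>"
  by (rule ext) (simp add: eval_at_def \<kappa>_def peval_def)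

lemma central_hom_\<iota>: "central_hom (\<lambda>c. [:\<iota> c:])"
  unfolding central_hom_def
proof (intro conjI allI)
  fix a y
  show "[:\<iota> a:] \<star> y = y \<star> [:\<iota> a:]"
    by (rule centralI)
      (simp_all add: skew_const_const \<iota>_comm skew_t_left skew_t_right t_mult_def map_poly_pCons)
qed (simp_all add: skew_const_const)

lemma g_t: "map_poly \<iota> g = (\<Sum>i\<le>E. [:\<iota> (coeff g i):] \<star> [:0, 1:] \<up> i)"
proof -
  have "(\<Sum>i\<le>E. [:\<iota> (coeff g i):] \<star> [:0, 1:] \<up> i) = (\<Sum>i\<le>E. monom (\<iota> (coeff g i)) i)"
    by (simp only: t_power skew_const_left smul_monom) simp
  also have "\<dots> = map_poly \<iota> g"
    by (rule poly_eqI) (auto simp: coeff_sum coeff_map_poly degree_g_E intro!: coeff_eq_0)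
  finally show ?thesis ..
qed

lemma const_poly_sum: "[:\<Sum>i\<in>A. u i:] = (\<Sum>i\<in>A. [:u i:])"
  by (rule poly_eqI) (simp add: coeff_sum coeff_pCons split: nat.splits)

text \<open>All exponents of \<open>g\<close> are powers of \<open>p\<close>, so the term of
  exponent \<open>i\<close> contributes only \<open>\<delta>^i\<close> to the commutator of
  \<open>g(t)\<close> with \<open>a\<close>. The sum is \<open>g(\<delta>)(a)\<close>, which the
  commutator with \<open>d\<^sub>0\<close> cancels. Commutation with \<open>t\<close> holds because
  \<open>\<delta>\<close> kills \<open>d\<^sub>0\<close> and the coefficients of
  \<open>g\<close>.\<close>

lemma x_central: "x \<star> y = y \<star> x"
proof (rule centralI)
  fix a
  have comm: "[:\<iota> c:] \<star> z = z \<star> [:\<iota> c:]" for c z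
    by (rule central_hom_comm[OF central_hom_\<iota>])
  have tm: "[:\<iota> (coeff g i):] \<star> [:0, 1:] \<up> i \<star> [:a:] =
      [:a:] \<star> ([:\<iota> (coeff g i):] \<star> [:0, 1:] \<up> i) + [:\<iota> (coeff g i) * (\<delta> ^^ i) a:]" for i
  proof (cases "coeff g i = 0")
    case False
    then obtain k where "i = p ^ k"
      using g_supp by blast
    then have "[:0, 1:] \<up> i \<star> [:a:] = [:a:] \<star> [:0, 1:] \<up> i + [:(\<delta> ^^ i) a:]"
      using t_power_const[OF prime_p char_p] by simp
    then have "[:\<iota> (coeff g i):] \<star> [:0, 1:] \<up> i \<star> [:a:] =
        [:\<iota> (coeff g i):] \<star> [:a:] \<star> [:0, 1:] \<up> i + [:\<iota> (coeff g i):] \<star> [:(\<delta> ^^ i) a:]"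
      by (simp only: skew_assoc skew_add_right)
    then show ?thesis
      by (simp only: comm[of _ "[:a:]"] skew_assoc) (simp add: skew_const_const)
  qed simp
  have "map_poly \<iota> g \<star> [:a:] = [:a:] \<star> map_poly \<iota> g + [:poly_in_derivation \<iota> \<delta> g a:]"
    unfolding g_t poly_in_derivation_def degree_g_E skew_sum_left skew_sum_right tm sum.distrib
    by (simp add: const_poly_sum)
  then show "x \<star> [:a:] = [:a:] \<star> x"
    by (simp add: x_def skew_diff_left skew_diff_right g_inner skew_const_const)
next
  have "map_poly \<iota> g \<star> [:0, 1:] = [:0, 1:] \<star> map_poly \<iota> g"
    by (simp add: skew_t_left skew_t_right t_mult_def) (rule poly_eqI, simp add: coeff_map_poly)
  then show "x \<star> [:0, 1:] = [:0, 1:] \<star> x"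
    by (simp add: x_def skew_diff_left skew_diff_right skew_t_left skew_t_right t_mult_def
        map_poly_pCons der_d0)
qed

lemma central_hom_\<kappa>: "central_hom \<kappa>"
  unfolding \<kappa>_def using central_hom_\<iota> x_central by (rule central_hom_peval)

lemmas \<kappa>_add = central_hom_add[OF central_hom_\<kappa>]
  and \<kappa>_mult = central_hom_mult[OF central_hom_\<kappa>]
  and \<kappa>_1 [simp] = central_hom_1[OF central_hom_\<kappa>]
  and \<kappa>_comm = central_hom_comm[OF central_hom_\<kappa>]
  and \<kappa>_0 [simp] = central_hom_0[OF central_hom_\<kappa>]
  and \<kappa>_power = central_hom_power[OF central_hom_\<kappa>]

lemma coeff_x: "coeff x E = 1" "i > E \<Longrightarrow> coeff x i = 0"
proof -
  have *: "coeff [:d\<^sub>0:] i = 0" if "i \<ge> E" for i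
    using that E_pos by (simp add: coeff_pCons split: nat.splits)
  show "coeff x E = 1"
    using * monic_g degree_g_E by (simp add: x_def coeff_map_poly)
  show "coeff x i = 0" if "i > E"
    using * that degree_g_E by (simp add: x_def coeff_map_poly coeff_eq_0)
qed

text \<open>\<open>x\<close> is monic of degree \<open>E\<close> in \<open>t\<close>, so
  substituting it moves the top coefficient from \<open>n\<close> to \<open>E * n\<close>. The bound
  \<open>n\<close> in place of the degree lets that coefficient be zero.\<close>

lemma coeff_\<kappa>:
  assumes "degree u \<le> n"
  shows "(\<forall>i > E * n. coeff (\<kappa> u) i = 0) \<and> coeff (\<kappa> u) (E * n) = \<iota> (coeff u n)"
  using assms
proof (induction u arbitrary: n)
  case 0
  then show ?case by simp
next
  case (pCons a u)
  have \<kappa>: "\<kappa> (pCons a u) = [:\<iota> a:] + x \<star> \<kappa> u"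
    unfolding \<kappa>_def by (rule peval_pCons[OF central_hom_\<iota>])
  show ?case
  proof (cases n)
    case 0
    then have "u = 0"
      using pCons.prems by (simp split: if_splits)
    then show ?thesis
      unfolding \<kappa> using 0 by (auto simp: coeff_pCons split: nat.splits)
  next
    case (Suc m)
    then have "degree u \<le> m"
      using pCons.prems by (simp split: if_splits)
    then have IH: "\<And>i. i > E * m \<Longrightarrow> coeff (\<kappa> u) i = 0" "coeff (\<kappa> u) (E * m) = \<iota> (coeff u m)"
      using pCons.IH by auto
    have *: "coeff [:\<iota> a:] i = 0" if "i \<ge> E * Suc m" for i
      using that E_pos by (auto simp: coeff_pCons split: nat.splits)
    show ?thesis
      using coeff_skew_top[of E x "E * m" "\<kappa> u", OF coeff_x(2) IH(1)] IH(2) coeff_x(1) *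
      by (simp add: \<kappa> Suc)
  qed
qed

lemma degree_\<kappa> [simp]: "degree (\<kappa> u) = E * degree u"
proof (cases "u = 0")
  case False
  have "degree (\<kappa> u) \<le> E * degree u"
    using coeff_\<kappa>[of u "degree u"] by (auto intro: degree_le)
  moreover have "coeff (\<kappa> u) (E * degree u) \<noteq> 0"
    using coeff_\<kappa>[of u "degree u"] False by simp
  ultimately show ?thesis
    by (simp add: le_antisym le_degree)
qed simp

lemma \<kappa>_eq_0_iff [simp]: "\<kappa> u = 0 \<longleftrightarrow> u = 0"
  using coeff_\<kappa>[of u "degree u"] by (metis \<iota>_eq_0_iff coeff_0 \<kappa>_0 leading_coeff_0_iff order_refl)

lemma \<kappa>_diff: "\<kappa> (u - v) = \<kappa> u - \<kappa> v"
  by (rule central_hom_diff[OF central_hom_\<kappa>])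

section \<open>Finiteness of \<open>D\<close> over \<open>F\<close> and of \<open>R\<close> over
  \<open>F[x]\<close>\<close>

abbreviation C :: "'a set"
  where "C \<equiv> {z. \<forall>y. z * y = y * z}"

lemma der_center: "z \<in> C \<Longrightarrow> (\<delta> ^^ i) z \<in> C"
proof (induction i)
  case (Suc i)
  let ?z = "(\<delta> ^^ i) z"
  have "\<delta> (?z * y) = \<delta> (y * ?z)" for y
    using Suc by simp
  then show ?case
    using Suc by (auto simp: der_mult)
qed simp

text \<open>The Wronskian argument: a solution \<open>c\<close> of minimal support of the system
  \<open>\<Sum> c\<^sub>z \<delta>\<^sup>i(z) = 0\<close>, normalised to have a coefficient \<open>1\<close>, is killed by \<open>\<delta>\<close> and by
  commutators, so its coefficients lie in \<open>F\<close>.\<close>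

lemma center_dependent:
  assumes Z: "finite Z" "Z \<subseteq> C" "card Z > E"
  shows "\<exists>c. (\<exists>z\<in>Z. c z \<noteq> 0) \<and> (\<Sum>z\<in>Z. \<iota> (c z) * z) = 0"
proof -
  define S where "S c \<longleftrightarrow> (\<forall>i<E. (\<Sum>z\<in>Z. c z * (\<delta> ^^ i) z) = 0)" for c
  define supp where "supp c = {z \<in> Z. c z \<noteq> 0}" for c :: "'a \<Rightarrow> 'a"
  have "\<exists>c. supp c \<noteq> {} \<and> S c"
    using nontrivial_solution[OF Z(1,3), of "\<lambda>i. \<delta> ^^ i"] by (auto simp: S_def supp_def)
  then obtain c0 where c0: "supp c0 \<noteq> {}" "S c0"
    and min: "\<And>c. supp c \<noteq> {} \<Longrightarrow> S c \<Longrightarrow> card (supp c0) \<le> card (supp c)"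
    using ex_has_least_nat[of "\<lambda>c. supp c \<noteq> {} \<and> S c" _ "\<lambda>c. card (supp c)"] by blast
  from c0 obtain z0 where z0: "z0 \<in> Z" "c0 z0 \<noteq> 0"
    by (auto simp: supp_def)
  define c where "c z = inverse (c0 z0) * c0 z" for z
  have supp_c: "supp c = supp c0" and c_z0: "c z0 = 1"
    using z0 by (auto simp: supp_def c_def)
  have Sc: "S c"
    using c0 by (simp add: S_def c_def mult.assoc flip: sum_distrib_left)
  \<comment> \<open>Minimality: a solution supported inside the support of \<open>c\<close> that
    misses \<open>z0\<close> has strictly smaller support, hence is zero.\<close>
  have vanish: "c' z = 0" if c': "S c'" "\<And>z. c z = 0 \<Longrightarrow> c' z = 0" "c' z0 = 0" and z: "z \<in> Z" for c' z
  proof (rule ccontr)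
    assume "c' z \<noteq> 0"
    then have "supp c' \<noteq> {}"
      using z by (auto simp: supp_def)
    moreover have "supp c' \<subseteq> supp c" "z0 \<in> supp c" "z0 \<notin> supp c'"
      using c'(2,3) c_z0 z0(1) by (auto simp only: supp_def mem_Collect_eq subset_eq one_neq_zero)
    then have "supp c' \<subset> supp c"
      by blast
    then have "card (supp c') < card (supp c)"
      using Z(1) by (intro psubset_card_mono) (auto simp: supp_def)
    ultimately show False
      using min[of c'] c'(1) supp_c by simp
  qed
  \<comment> \<open>One row more than \<open>S\<close> demands: \<open>g(\<delta>)\<close> vanishes
    on the centre and \<open>g\<close> is monic of degree \<open>E\<close>, so row \<open>E\<close>
    follows from the earlier ones. Differentiating row \<open>i\<close> brings in row
    \<open>Suc i\<close>, hence the need for it.\<close>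
  have rows: "(\<Sum>z\<in>Z. c z * (\<delta> ^^ i) z) = 0" if "i \<le> E" for i
  proof (cases "i < E")
    case True
    then show ?thesis
      using Sc by (simp add: S_def)
  next
    case False
    then have i: "i = E"
      using that by simp
    have "poly_in_derivation \<iota> \<delta> g z = 0" if "z \<in> Z" for z
      using Z(2) that g_inner[of z] by auto
    then have "0 = (\<Sum>z\<in>Z. c z * poly_in_derivation \<iota> \<delta> g z)"
      by simp
    also have "\<dots> = (\<Sum>z\<in>Z. \<Sum>j\<le>E. \<iota> (coeff g j) * (c z * (\<delta> ^^ j) z))"
      unfolding poly_in_derivation_def degree_g_E sum_distrib_left
      by (intro sum.cong refl) (metis mult.assoc \<iota>_comm)
    also have "\<dots> = (\<Sum>j\<le>E. \<iota> (coeff g j) * (\<Sum>z\<in>Z. c z * (\<delta> ^^ j) z))"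
      unfolding sum_distrib_left by (rule sum.swap)
    also have "\<dots> = (\<Sum>j\<in>{E}. \<iota> (coeff g j) * (\<Sum>z\<in>Z. c z * (\<delta> ^^ j) z))"
      using Sc by (intro sum.mono_neutral_right) (auto simp: S_def)
    finally show ?thesis
      using monic_g degree_g_E i by simp
  qed
  have "\<delta> (c z) = 0" if "z \<in> Z" for z
  proof (rule vanish[of "\<lambda>z. \<delta> (c z)"])
    show "S (\<lambda>z. \<delta> (c z))"
      unfolding S_def
    proof (intro allI impI)
      fix i assume i: "i < E"
      have "0 = \<delta> (\<Sum>z\<in>Z. c z * (\<delta> ^^ i) z)"
        using rows i by simp
      also have "\<dots> = (\<Sum>z\<in>Z. c z * (\<delta> ^^ Suc i) z) + (\<Sum>z\<in>Z. \<delta> (c z) * (\<delta> ^^ i) z)"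
        by (simp add: der_sum der_mult sum.distrib)
      finally show "(\<Sum>z\<in>Z. \<delta> (c z) * (\<delta> ^^ i) z) = 0"
        using rows[of "Suc i"] i by simp
    qed
  qed (use that c_z0 in auto)
  moreover have "c z \<in> C" if "z \<in> Z" for z
  proof -
    \<comment> \<open>The elements \<open>\<delta>^i(z)\<close> are central, so multiplying the
      system by \<open>a\<close> from either side and subtracting gives another solution.\<close>
    have "a * c z - c z * a = 0" for a
    proof (rule vanish[of "\<lambda>z. a * c z - c z * a"])
      show "S (\<lambda>z. a * c z - c z * a)"
        unfolding S_def
      proof (intro allI impI)
        fix i assume i: "i < E"
        have "(\<Sum>z\<in>Z. (a * c z - c z * a) * (\<delta> ^^ i) z) =
            (\<Sum>z\<in>Z. a * (c z * (\<delta> ^^ i) z) - c z * (\<delta> ^^ i) z * a)"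
        proof (rule sum.cong)
          fix z assume "z \<in> Z"
          then have "(\<delta> ^^ i) z * a = a * (\<delta> ^^ i) z"
            using der_center[of z i] Z(2) by blast
          then show "(a * c z - c z * a) * (\<delta> ^^ i) z = a * (c z * (\<delta> ^^ i) z) - c z * (\<delta> ^^ i) z * a"
            by (simp add: left_diff_distrib mult.assoc)
        qed simp
        also have "\<dots> = 0"
          using rows[of i] i by (simp add: sum_subtractf flip: sum_distrib_left sum_distrib_right)
        finally show "(\<Sum>z\<in>Z. (a * c z - c z * a) * (\<delta> ^^ i) z) = 0" .
      qed
    qed (use that c_z0 in auto)
    then show ?thesis
      by simp
  qed
  ultimately have "c z \<in> range \<iota>" if "z \<in> Z" for z
    using that unfolding range_\<iota> by blast
  then have "\<forall>z\<in>Z. \<exists>b. \<iota> b = c z"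
    by (metis imageE)
  then obtain b where b: "\<And>z. z \<in> Z \<Longrightarrow> \<iota> (b z) = c z"
    by metis
  have "(\<Sum>z\<in>Z. \<iota> (b z) * z) = 0"
    using rows[of 0] b by simp
  moreover have "b z0 \<noteq> 0"
    using b[OF z0(1)] c_z0 by auto
  ultimately show ?thesis
    using z0 by blast
qed

text \<open>Tower law for \<open>F\<close>, the centre and \<open>D\<close>. By
  \<open>center_dependent\<close> an \<open>F\<close>-independent subset of the centre has at most
  \<open>E\<close> elements, so a maximal one is a finite basis; its products with a spanning set
  over the centre span \<open>D\<close>.\<close>

lemma finite_over_F:
  "\<exists>W. finite W \<and> (\<forall>a. \<exists>u. a = (\<Sum>w\<in>W. \<iota> (u w) * w))"
proof -
  interpret V: vector_space "\<lambda>c z. \<iota> c * z"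
    by unfold_locales (simp_all add: algebra_simps)
  obtain B where B: "B \<subseteq> C" "V.independent B" "C \<subseteq> V.span B"
    using V.maximal_independent_subset by blast
  have "finite B"
  proof (rule ccontr)
    assume "infinite B"
    then obtain Z where Z: "finite Z" "card Z = Suc E" "Z \<subseteq> B"
      using infinite_arbitrarily_large by blast
    then have "Z \<subseteq> C" "card Z > E"
      using B(1) by (blast, simp)
    with center_dependent[OF Z(1)] obtain c where "\<exists>z\<in>Z. c z \<noteq> 0" "(\<Sum>z\<in>Z. \<iota> (c z) * z) = 0"
      by blast
    then show False
      using V.independentD[OF B(2) Z(1,3), of c] by blast
  qed
  from finite_over_center obtain B' where B': "finite B'"
    "\<forall>a. \<exists>u. (\<forall>b\<in>B'. u b \<in> C) \<and> a = (\<Sum>b\<in>B'. u b * b)"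
    by (elim exE conjE)
  define W where "W = (\<lambda>(b, b'). b * b') ` (B \<times> B')"
  have W: "finite W"
    using \<open>finite B\<close> B' by (simp add: W_def)
  have mult: "z * b' \<in> V.span W" if "z \<in> C" "b' \<in> B'" for z b'
  proof -
    have "z \<in> V.span B"
      using B that by blast
    then obtain u where "z = (\<Sum>b\<in>B. \<iota> (u b) * b)"
      using V.span_finite[OF \<open>finite B\<close>] by auto
    then have "z * b' = (\<Sum>b\<in>B. \<iota> (u b) * (b * b'))"
      by (simp add: sum_distrib_right mult.assoc)
    also have "\<dots> \<in> V.span W"
      using that by (intro V.span_sum V.span_scale V.span_base) (auto simp: W_def)
    finally show ?thesis .
  qed
  have "a \<in> V.span W" for a
  proof -
    obtain u where u: "\<forall>b\<in>B'. u b \<in> C" "a = (\<Sum>b\<in>B'. u b * b)"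
      using B'(2)[rule_format, of a] by (elim exE conjE)
    show ?thesis
      unfolding u(2) using u(1) by (intro V.span_sum mult) auto
  qed
  then show ?thesis
    using V.span_finite[OF W] W by (metis (no_types, lifting) imageE)
qed

lemma \<kappa>_sum: "\<kappa> (\<Sum>i\<in>A. u i) = (\<Sum>i\<in>A. \<kappa> (u i))"
  by (induction A rule: infinite_finite_induct) (simp_all add: \<kappa>_add)

lemma coeff_\<kappa>_monom:
  assumes "i \<ge> E * q + j"
  shows "coeff (\<kappa> (monom b q) \<star> monom w j) i = (if i = E * q + j then \<iota> b * w else 0)"
proof -
  have "degree (monom b q) \<le> q"
    by (rule degree_monom_le)
  note \<kappa> = coeff_\<kappa>[OF this]
  have "coeff (\<kappa> (monom b q) \<star> monom w j) i = 0" if "i > E * q + j"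
    by (rule coeff_skew_top(1)[OF _ _ that]) (use \<kappa> in auto)
  moreover have "coeff (\<kappa> (monom b q) \<star> monom w j) (E * q + j) = \<iota> b * w"
    by (subst coeff_skew_top(2)) (use \<kappa> in auto)
  ultimately show ?thesis
    using assms by auto
qed

text \<open>The generators are \<open>w t^j\<close> with \<open>w\<close> from a spanning set of
  \<open>D\<close> over \<open>F\<close> and \<open>j < E\<close>. Since \<open>x^q w t^j\<close>
  has leading term \<open>w t^(E q + j)\<close>, leading terms can be stripped one by one. The
  degree bound on the coefficients feeds the norm estimate.\<close>

lemma finite_generators:
  obtains W where "finite W"
    "\<And>f k. degree f \<le> k \<Longrightarrow> \<exists>u. f = (\<Sum>w\<in>W. \<kappa> (u w) \<star> w) \<and> (\<forall>w. E * degree (u w) \<le> k)"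
proof -
  obtain W0 where W0: "finite W0" "\<And>a. \<exists>u. a = (\<Sum>w\<in>W0. \<iota> (u w) * w)"
    using finite_over_F by blast
  define I where "I = W0 \<times> {..<E}"
  have I: "finite I"
    using W0 by (simp add: I_def)
  \<comment> \<open>\<open>k\<close> counts coefficients, so the degree is at most
    \<open>k - 1\<close>; at \<open>k = 0\<close> the truncated difference is harmless, as all
    coefficients vanish.\<close>
  have step: "\<exists>u. f = (\<Sum>(w, j)\<in>I. \<kappa> (u (w, j)) \<star> monom w j) \<and> (\<forall>i. E * degree (u i) \<le> k - 1)"
    if "\<forall>i\<ge>k. coeff f i = 0" for f k
    using that
  proof (induction k arbitrary: f)
    case 0
    then have "f = 0"
      by (intro poly_eqI) simp
    then show ?case
      by (intro exI[of _ "\<lambda>_. 0"]) (simp add: case_prod_unfold)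
  next
    case (Suc k)
    obtain b where b: "coeff f k = (\<Sum>w\<in>W0. \<iota> (b w) * w)"
      using W0(2) by blast
    let ?q = "k div E" and ?j = "k mod E"
    define f' where "f' = (\<Sum>w\<in>W0. \<kappa> (monom (b w) ?q) \<star> monom w ?j)"
    have k: "k = E * ?q + ?j"
      by simp
    have "coeff (f - f') i = 0" if "i \<ge> k" for i
    proof (cases "i = k")
      case True
      then show ?thesis
        using coeff_\<kappa>_monom[of ?q ?j k] by (simp add: f'_def b coeff_sum)
    next
      case False
      then have "i \<ge> Suc k"
        using that by simp
      then show ?thesis
        using coeff_\<kappa>_monom[of ?q ?j i] Suc.prems by (simp add: f'_def coeff_sum)
    qed
    then obtain u where u: "f - f' = (\<Sum>(w, j)\<in>I. \<kappa> (u (w, j)) \<star> monom w j)"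
      "\<And>i. E * degree (u i) \<le> k - 1"
      using Suc.IH[of "f - f'"] by blast
    define v where "v i = (if snd i = ?j then monom (b (fst i)) ?q else 0)" for i
    have "f' = (\<Sum>w\<in>W0. \<Sum>j<E. \<kappa> (v (w, j)) \<star> monom w j)"
      unfolding f'_def
    proof (rule sum.cong)
      fix w
      have "(\<Sum>j<E. \<kappa> (v (w, j)) \<star> monom w j) =
          (\<Sum>j<E. if j = ?j then \<kappa> (monom (b w) ?q) \<star> monom w ?j else 0)"
        by (rule sum.cong) (auto simp: v_def)
      also have "\<dots> = \<kappa> (monom (b w) ?q) \<star> monom w ?j"
        using E_pos by simp
      finally show "\<kappa> (monom (b w) ?q) \<star> monom w ?j = (\<Sum>j<E. \<kappa> (v (w, j)) \<star> monom w j)" ..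
    qed simp
    also have "\<dots> = (\<Sum>(w, j)\<in>I. \<kappa> (v (w, j)) \<star> monom w j)"
      using W0(1) by (simp add: I_def sum.cartesian_product)
    finally have "f = (\<Sum>(w, j)\<in>I. \<kappa> (u (w, j)) \<star> monom w j) + (\<Sum>(w, j)\<in>I. \<kappa> (v (w, j)) \<star> monom w j)"
      using u(1) by (simp add: algebra_simps)
    also have "\<dots> = (\<Sum>(w, j)\<in>I. \<kappa> (u (w, j) + v (w, j)) \<star> monom w j)"
      by (simp add: \<kappa>_add skew_add_left sum.distrib case_prod_unfold)
    finally have "f = (\<Sum>(w, j)\<in>I. \<kappa> (u (w, j) + v (w, j)) \<star> monom w j)" .
    moreover have "E * degree (u i + v i) \<le> k" for i
    proof -
      have "degree (v i) \<le> ?q"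
        by (simp add: v_def degree_monom_le)
      then have "E * degree (v i) \<le> E * ?q"
        by simp
      also have "\<dots> \<le> k"
        by simp
      finally have "E * degree (v i) \<le> k" .
      moreover have "degree (u i + v i) \<le> max (degree (u i)) (degree (v i))"
        by (rule degree_add_le_max)
      then have "E * degree (u i + v i) \<le> max (E * degree (u i)) (E * degree (v i))"
        unfolding nat_mult_max_right[symmetric] by (rule mult_le_mono2)
      ultimately show ?thesis
        using u(2)[of i] by linarith
    qed
    ultimately show ?case
      by (intro exI[of _ "\<lambda>i. u i + v i"]) simp
  qed
  show thesis
  proof (rule that)
    let ?m = "\<lambda>(w, j). monom w j :: 'a poly"
    show "finite (?m ` I)"
      using I by simp
    fix f :: "'a poly" and k assume f: "degree f \<le> (k :: nat)"
    then have "\<forall>i\<ge>Suc k. coeff f i = 0"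
      by (simp add: coeff_eq_0)
    from step[OF this] obtain u where u: "f = (\<Sum>(w, j)\<in>I. \<kappa> (u (w, j)) \<star> monom w j)"
      "\<And>i. E * degree (u i) \<le> k"
      by auto
    \<comment> \<open>Distinct pairs can give the same generator, namely 0 if \<open>W0\<close>
      contains 0; so the coefficients over each fibre are added.\<close>
    define v where "v w = (\<Sum>i\<in>{i \<in> I. ?m i = w}. u i)" for w
    have "f = (\<Sum>i\<in>I. \<kappa> (u i) \<star> ?m i)"
      using u(1) by (simp add: case_prod_unfold)
    also have "\<dots> = (\<Sum>w\<in>?m ` I. \<Sum>i\<in>{i \<in> I. ?m i = w}. \<kappa> (u i) \<star> ?m i)"
      using I by (rule sum.image_gen)
    also have "\<dots> = (\<Sum>w\<in>?m ` I. \<kappa> (v w) \<star> w)"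
      by (simp add: v_def \<kappa>_sum skew_sum_left)
    finally have "f = (\<Sum>w\<in>?m ` I. \<kappa> (v w) \<star> w)" .
    moreover have "E * degree (v w) \<le> k" for w
    proof -
      have "degree (v w) \<le> k div E"
        unfolding v_def using u(2) E_pos
        by (intro degree_sum_le) (use I in \<open>auto simp: less_eq_div_iff_mult_less_eq mult.commute\<close>)
      then show ?thesis
        using E_pos by (simp add: less_eq_div_iff_mult_less_eq mult.commute)
    qed
    ultimately show "\<exists>u. f = (\<Sum>w\<in>?m ` I. \<kappa> (u w) \<star> w) \<and> (\<forall>w. E * degree (u w) \<le> k)"
      by blast
  qed
qed

end

subsection \<open>Integrality and degree of the reduced norm\<close>

lemma poly_exists_irreducible_factor:
  fixes u :: "'f::field poly"
  assumes "u \<noteq> 0" "\<not> u dvd 1"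
  shows "\<exists>q. irreducible q \<and> q dvd u"
  using assms
proof (induction "degree u" arbitrary: u rule: less_induct)
  case less
  show ?case
  proof (cases "irreducible u")
    case False
    then obtain a b where ab: "u = a * b" "\<not> a dvd 1" "\<not> b dvd 1"
      using less.prems by (auto simp: irreducible_def)
    have "degree a > 0" "degree b > 0" "a \<noteq> 0" "b \<noteq> 0"
      using ab less.prems by (auto simp: is_unit_iff_degree)
    then have "degree a < degree u"
      by (simp add: ab(1) degree_mult_eq)
    then obtain q where "irreducible q" "q dvd a"
      using less.hyps[of a] ab(2) \<open>a \<noteq> 0\<close> by blast
    then show ?thesis
      using ab(1) by (intro exI[of _ q]) (simp add: dvd_mult2)
  qed (use dvd_refl in blast)
qed

lemma degree_power_eq': "degree (u ^ s) = s * degree (u :: 'f::field poly)"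
  by (cases "u = 0"; cases s) (simp_all add: degree_power_eq degree_mult_eq)

lemma to_fract_prod: "to_fract (prod u A) = (\<Prod>i\<in>A. to_fract (u i))"
  by (induction A rule: infinite_finite_induct) simp_all

lemma to_fract_sum: "to_fract (sum u A) = (\<Sum>i\<in>A. to_fract (u i))"
  by (induction A rule: infinite_finite_induct) simp_all

lemma to_fract_power: "to_fract (u ^ n) = to_fract u ^ n"
  by (induction n) simp_all

text \<open>\<open>F[x]\<close> is completely integrally closed: an irreducible factor of the
  reduced denominator of \<open>r\<close> would divide \<open>\<Delta>\<close> to every
  power.\<close>

lemma fract_integral:
  fixes r :: "'f::field poly fract"
  assumes \<Delta>: "\<Delta> \<noteq> 0" and bounded: "\<And>s. \<exists>v. to_fract \<Delta> * r ^ s = to_fract v"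
  shows "\<exists>v. r = to_fract v"
proof -
  have "\<exists>b a. b \<noteq> 0 \<and> r = to_fract a / to_fract b"
    by (cases r) (metis Fract_conv_to_fract)
  \<comment> \<open>A denominator of least degree takes the place of coprimality.\<close>
  then obtain a b where ab: "b \<noteq> 0" "r = to_fract a / to_fract b"
    and min: "\<And>a' b'. b' \<noteq> 0 \<Longrightarrow> r = to_fract a' / to_fract b' \<Longrightarrow> degree b \<le> degree b'"
    using ex_has_least_nat[of "\<lambda>b. b \<noteq> 0 \<and> (\<exists>a. r = to_fract a / to_fract b)" _ degree] by metis
  show ?thesis
  proof (cases "b dvd 1")
    case True
    then obtain b' where "1 = b * b'"
      by (elim dvdE)
    then have "to_fract b * to_fract b' = 1"
      by (simp flip: to_fract_mult)
    then have "r = r * to_fract b * to_fract b'"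
      by (simp add: mult.assoc)
    also have "\<dots> = to_fract (a * b')"
      using ab by simp
    finally have "r = to_fract (a * b')" .
    then show ?thesis ..
  next
    case False
    then obtain q where q: "irreducible q" "q dvd b"
      using poly_exists_irreducible_factor ab(1) by blast
    then have prime: "prime_elem q"
      by (simp add: field_poly_irreducible_imp_prime)
    have "q \<noteq> 0" "\<not> q dvd 1" "degree q > 0"
      using q(1) by (auto simp: irreducible_def is_unit_iff_degree)
    have "\<not> q dvd a"
    proof
      assume "q dvd a"
      then obtain a' b' where "a = q * a'" "b = q * b'"
        using q(2) by (auto elim!: dvdE)
      moreover from this have "b' \<noteq> 0" "degree b' < degree b"
        using ab(1) \<open>degree q > 0\<close> by (auto simp: degree_mult_eq)
      moreover have "r = to_fract a' / to_fract b'"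
        using ab calculation \<open>q \<noteq> 0\<close> by simp
      ultimately show False
        using min[of b' a'] by simp
    qed
    have "q ^ s dvd \<Delta>" for s
    proof -
      obtain v where "to_fract \<Delta> * r ^ s = to_fract v"
        using bounded by blast
      then have "to_fract (\<Delta> * a ^ s) = to_fract (v * b ^ s)"
        using ab by (simp add: to_fract_power power_divide field_simps)
      then have "\<Delta> * a ^ s = v * b ^ s"
        by (simp only: to_fract_eq_iff)
      then have "q ^ s dvd \<Delta> * a ^ s"
        using q(2) by (simp add: dvd_mult dvd_power_same)
      moreover have "\<not> q dvd a ^ s"
        using prime \<open>\<not> q dvd a\<close> prime_elem_dvd_power by blast
      ultimately show ?thesis
        using prime_elem_power_dvd_cases[OF _ _ prime, of s \<Delta> "a ^ s" s 1] by simp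
    qed
    then have "degree (q ^ Suc (degree \<Delta>)) \<le> degree \<Delta>"
      using dvd_imp_degree_le \<Delta> by blast
    then have "Suc (degree \<Delta>) * degree q \<le> degree \<Delta>"
      by (simp only: degree_power_eq')
    moreover have "Suc (degree \<Delta>) * 1 \<le> Suc (degree \<Delta>) * degree q"
      using \<open>degree q > 0\<close> by (intro mult_le_mono2) simp
    ultimately show ?thesis
      by simp
  qed
qed

lemma common_denominator:
  fixes c :: "'t \<Rightarrow> 'f::field poly fract"
  assumes "finite T"
  shows "\<exists>\<Delta> v. \<Delta> \<noteq> 0 \<and> (\<forall>i\<in>T. to_fract \<Delta> * c i = to_fract (v i))"
  using assms
proof (induction T rule: finite_induct)
  case empty
  then show ?case
    by (intro exI[of _ 1]) simp
next
  case (insert i T)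
  then obtain \<Delta> v where IH: "\<Delta> \<noteq> 0" "\<And>j. j \<in> T \<Longrightarrow> to_fract \<Delta> * c j = to_fract (v j)"
    by blast
  obtain a b where ab: "b \<noteq> 0" "c i = to_fract a / to_fract b"
    by (cases "c i") (metis Fract_conv_to_fract)
  have "to_fract (\<Delta> * b) * c j = to_fract (if j = i then \<Delta> * a else b * v j)" if "j \<in> insert i T" for j
    using that ab IH by (auto simp: mult.assoc mult.left_commute)
  then show ?case
    using IH ab by (intro exI[of _ "\<Delta> * b"] exI[of _ "\<lambda>j. if j = i then \<Delta> * a else b * v j"]) simp
qed

text \<open>\<open>{1}\<close> extends to a \<open>K\<close>-basis of the closure. Linearity
  suffices for pulling scalars of \<open>K\<close> out of a sum; multiplicativity is not
  claimed.\<close>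

lemma alg_closure_retraction:
  obtains \<rho> :: "'k::field alg_closure \<Rightarrow> 'k"
  where "\<And>a b. \<rho> (a + b) = \<rho> a + \<rho> b" "\<And>k a. \<rho> (to_ac k * a) = k * \<rho> a" "\<rho> 1 = 1"
proof -
  interpret V: vector_space_pair "\<lambda>k a. to_ac k * a" "(*) :: 'k \<Rightarrow> 'k \<Rightarrow> 'k"
    by unfold_locales (simp_all add: algebra_simps)
  have "V.vs1.independent {1}"
    by simp
  then obtain \<rho> :: "'k alg_closure \<Rightarrow> 'k" where "Vector_Spaces.linear (\<lambda>k a. to_ac k * a) (*) \<rho>" "\<rho> 1 = 1"
    using V.linear_independent_extend[of "{1}" "\<lambda>_. 1"] by auto
  then show thesis
    by (intro that[of \<rho>]) (simp_all add: Vector_Spaces.linear_iff)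
qed

text \<open>Multilinearity in the rows: \<open>\<tau> r\<close> selects the summand used for row
  \<open>r\<close>, and the determinants on the right depend on the fixed matrices only.\<close>

lemma det_linear_combination:
  fixes \<Phi> :: "'i \<Rightarrow> 'l::comm_ring_1 mat"
  assumes "finite I"
  shows "det (mat n n (\<lambda>(r, s). \<Sum>i\<in>I. a i * \<Phi> i $$ (r, s))) =
    (\<Sum>\<tau>\<in>{0..<n} \<rightarrow>\<^sub>E I. (\<Prod>k=0..<n. a (\<tau> k)) * det (mat n n (\<lambda>(r, s). \<Phi> (\<tau> r) $$ (r, s))))"
proof -
  let ?P = "{\<pi>. \<pi> permutes {0..<n}}" and ?T = "{0..<n} \<rightarrow>\<^sub>E I"
  have "det (mat n n (\<lambda>(r, s). \<Sum>i\<in>I. a i * \<Phi> i $$ (r, s))) =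
      (\<Sum>\<pi>\<in>?P. signof \<pi> * (\<Prod>r=0..<n. \<Sum>i\<in>I. a i * \<Phi> i $$ (r, \<pi> r)))"
    by (subst det_def'[of _ n]) (auto intro!: sum.cong prod.cong dest: permutes_in_image)
  also have "\<dots> = (\<Sum>\<pi>\<in>?P. \<Sum>\<tau>\<in>?T. (\<Prod>k=0..<n. a (\<tau> k)) * (signof \<pi> * (\<Prod>r=0..<n. \<Phi> (\<tau> r) $$ (r, \<pi> r))))"
    using assms by (simp add: prod_sum_PiE sum_distrib_left prod.distrib mult.left_commute)
  also have "\<dots> = (\<Sum>\<tau>\<in>?T. (\<Prod>k=0..<n. a (\<tau> k)) * (\<Sum>\<pi>\<in>?P. signof \<pi> * (\<Prod>r=0..<n. \<Phi> (\<tau> r) $$ (r, \<pi> r))))"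
    by (subst sum.swap) (simp add: sum_distrib_left)
  also have "\<dots> = (\<Sum>\<tau>\<in>?T. (\<Prod>k=0..<n. a (\<tau> k)) * det (mat n n (\<lambda>(r, s). \<Phi> (\<tau> r) $$ (r, s))))"
  proof (rule sum.cong)
    fix \<tau>
    have "det (mat n n (\<lambda>(r, s). \<Phi> (\<tau> r) $$ (r, s))) =
        (\<Sum>\<pi>\<in>?P. signof \<pi> * (\<Prod>r=0..<n. \<Phi> (\<tau> r) $$ (r, \<pi> r)))"
      by (subst det_def'[of _ n]) (auto intro!: sum.cong prod.cong dest: permutes_in_image)
    then show "(\<Prod>k=0..<n. a (\<tau> k)) * (\<Sum>\<pi>\<in>?P. signof \<pi> * (\<Prod>r=0..<n. \<Phi> (\<tau> r) $$ (r, \<pi> r))) =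
        (\<Prod>k=0..<n. a (\<tau> k)) * det (mat n n (\<lambda>(r, s). \<Phi> (\<tau> r) $$ (r, s)))"
      by simp
  qed simp
  finally show ?thesis .
qed

text \<open>Here \<open>\<psi> f\<close> stands for the image of \<open>f / 1\<close> under a splitting of \<open>D(t;\<delta>)\<close>.\<close>

locale skew_norm = skew_center \<delta> \<iota> p e g d\<^sub>0
  for \<delta> :: "'a::division_ring \<Rightarrow> 'a" and \<iota> :: "'f::field \<Rightarrow> 'a" and p e g d\<^sub>0 +
  fixes d n :: nat and \<psi> :: "'a poly \<Rightarrow> 'f poly fract alg_closure mat"
    and N :: "'a poly \<Rightarrow> 'f poly fract"
  assumes \<psi>_carrier: "\<psi> f \<in> carrier_mat n n"
    and \<psi>_add: "\<psi> (f + q) = \<psi> f + \<psi> q"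
    and \<psi>_mult: "\<psi> (f \<star> q) = \<psi> f * \<psi> q"
    and \<psi>_\<kappa>: "\<psi> (\<kappa> u) = to_ac (to_fract u) \<cdot>\<^sub>m 1\<^sub>m n"
    and det_\<psi>: "det (\<psi> f) = to_ac (N f)"
    and n_def: "n = E * d" and d_pos: "d > 0"
begin

section \<open>The norm on \<open>R\<close>: values in \<open>F[x]\<close>, degree and leading
  coefficient\<close>

lemma N_mult: "N (f \<star> q) = N f * N q"
proof -
  have "to_ac (N (f \<star> q)) = to_ac (N f * N q)"
    by (simp add: \<psi>_mult det_mult[OF \<psi>_carrier \<psi>_carrier] flip: det_\<psi>)
  then show ?thesis
    by (simp only: to_ac_eq_iff)
qed

lemma N_\<kappa>: "N (\<kappa> u) = to_fract (u ^ n)"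
proof -
  have "to_ac (N (\<kappa> u)) = to_ac (to_fract (u ^ n))"
    by (simp add: \<psi>_\<kappa> to_fract_power flip: det_\<psi>)
  then show ?thesis
    by (simp only: to_ac_eq_iff)
qed

lemma N_1: "N [:1:] = 1"
  using N_\<kappa>[of 1] by simp

lemma N_power: "N (f \<up> s) = N f ^ s"
  by (induction s) (simp_all add: N_1 N_mult)

lemma \<psi>_index_sum:
  assumes "r < n" "s < n"
  shows "\<psi> (\<Sum>i\<in>A. u i) $$ (r, s) = (\<Sum>i\<in>A. \<psi> (u i) $$ (r, s))"
proof -
  have "\<psi> 0 $$ (r, s) = 0"
    using \<psi>_\<kappa>[of 0] assms by simp
  moreover have "\<psi> (f + q) $$ (r, s) = \<psi> f $$ (r, s) + \<psi> q $$ (r, s)" for f q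
    using \<psi>_carrier[of f] \<psi>_carrier[of q] assms by (simp add: \<psi>_add)
  ultimately show ?thesis
    by (induction A rule: infinite_finite_induct) simp_all
qed

text \<open>The norm of a combination of fixed elements is a polynomial in the coefficients. Its
  coefficients lie in the algebraic closure of \<open>F(x)\<close>; a linear retraction onto \<open>F(x)\<close> moves
  them into \<open>F(x)\<close>, as the norm takes values there.\<close>

lemma N_expansion:
  assumes I: "finite I" and i0: "i0 \<in> I" "w i0 = [:1:]"
  obtains \<Delta> v where "\<Delta> \<noteq> 0"
    "\<And>a. to_fract \<Delta> * N (\<Sum>i\<in>I. \<kappa> (a i) \<star> w i) =
      to_fract (\<Sum>\<tau>\<in>{0..<n} \<rightarrow>\<^sub>E I. v \<tau> * (\<Prod>k=0..<n. a (\<tau> k)))"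
    "v (\<lambda>k\<in>{0..<n}. i0) = \<Delta>"
proof -
  let ?T = "{0..<n} \<rightarrow>\<^sub>E I"
  obtain \<rho> :: "'f poly fract alg_closure \<Rightarrow> 'f poly fract"
    where \<rho>: "\<And>a b. \<rho> (a + b) = \<rho> a + \<rho> b" "\<And>k a. \<rho> (to_ac k * a) = k * \<rho> a" "\<rho> 1 = 1"
    using alg_closure_retraction by blast
  have \<rho>_to_ac: "\<rho> (to_ac k) = k" for k
    using \<rho>(2)[of k 1] \<rho>(3) by simp
  have \<rho>_sum: "\<rho> (\<Sum>i\<in>A. f i) = (\<Sum>i\<in>A. \<rho> (f i))" for f and A :: "(nat \<Rightarrow> 'b) set"
    using \<rho>(2)[of 0 0] by (induction A rule: infinite_finite_induct) (simp_all add: \<rho>(1))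
  define c where "c \<tau> = \<rho> (det (mat n n (\<lambda>(r, s). \<psi> (w (\<tau> r)) $$ (r, s))))" for \<tau>
  have N: "N (\<Sum>i\<in>I. \<kappa> (a i) \<star> w i) = (\<Sum>\<tau>\<in>?T. (\<Prod>k=0..<n. to_fract (a (\<tau> k))) * c \<tau>)" for a
  proof -
    have "\<psi> (\<Sum>i\<in>I. \<kappa> (a i) \<star> w i) =
        mat n n (\<lambda>(r, s). \<Sum>i\<in>I. to_ac (to_fract (a i)) * \<psi> (w i) $$ (r, s))"
    proof (rule eq_matI)
      fix r s assume "r < dim_row (mat n n (\<lambda>(r, s). \<Sum>i\<in>I. to_ac (to_fract (a i)) * \<psi> (w i) $$ (r, s)))"
        "s < dim_col (mat n n (\<lambda>(r, s). \<Sum>i\<in>I. to_ac (to_fract (a i)) * \<psi> (w i) $$ (r, s)))"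
      then have rs: "r < n" "s < n"
        by simp_all
      have "\<psi> (\<kappa> u \<star> q) $$ (r, s) = to_ac (to_fract u) * \<psi> q $$ (r, s)" for u q
        using rs \<psi>_carrier[of q] by (simp add: \<psi>_mult \<psi>_\<kappa> mult_smult_assoc_mat[of _ n n _ n])
      then show "\<psi> (\<Sum>i\<in>I. \<kappa> (a i) \<star> w i) $$ (r, s) =
          mat n n (\<lambda>(r, s). \<Sum>i\<in>I. to_ac (to_fract (a i)) * \<psi> (w i) $$ (r, s)) $$ (r, s)"
        using rs by (simp add: \<psi>_index_sum)
    qed (use \<psi>_carrier in auto)
    then have "to_ac (N (\<Sum>i\<in>I. \<kappa> (a i) \<star> w i)) = (\<Sum>\<tau>\<in>?T. (\<Prod>k=0..<n. to_ac (to_fract (a (\<tau> k)))) *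
        det (mat n n (\<lambda>(r, s). \<psi> (w (\<tau> r)) $$ (r, s))))"
      using det_linear_combination[OF I, where \<Phi> = "\<lambda>i. \<psi> (w i)"] by (simp flip: det_\<psi>)
    then have "\<rho> (to_ac (N (\<Sum>i\<in>I. \<kappa> (a i) \<star> w i))) =
        \<rho> (\<Sum>\<tau>\<in>?T. to_ac (\<Prod>k=0..<n. to_fract (a (\<tau> k))) *
        det (mat n n (\<lambda>(r, s). \<psi> (w (\<tau> r)) $$ (r, s))))"
      by (simp add: to_ac_prod)
    then show ?thesis
      by (simp add: \<rho>_to_ac \<rho>_sum \<rho>(2) c_def)
  qed
  \<comment> \<open>The selection taking \<open>i0\<close> in every row contributes the determinant
    of the identity matrix. After clearing denominators its coefficient is exactly
    \<open>\<Delta>\<close>, which becomes the coefficient of the dominant term later.\<close>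
  have c_1: "c (\<lambda>k\<in>{0..<n}. i0) = 1"
  proof -
    have "1 \<cdot>\<^sub>m 1\<^sub>m n = (1\<^sub>m n :: 'f poly fract alg_closure mat)"
      by (intro eq_matI) auto
    then have "\<psi> [:1:] = 1\<^sub>m n"
      using \<psi>_\<kappa>[of 1] by simp
    then have "mat n n (\<lambda>(r, s). \<psi> (w ((\<lambda>k\<in>{0..<n}. i0) r)) $$ (r, s)) = 1\<^sub>m n"
      by (intro eq_matI) (auto simp: i0)
    then show ?thesis
      by (simp add: c_def \<rho>(3))
  qed
  have T: "finite ?T"
    using I by (intro finite_PiE) auto
  obtain \<Delta> v where \<Delta>: "\<Delta> \<noteq> 0" "\<And>\<tau>. \<tau> \<in> ?T \<Longrightarrow> to_fract \<Delta> * c \<tau> = to_fract (v \<tau>)"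
    using common_denominator[OF T, of c] by blast
  show thesis
  proof (rule that[OF \<Delta>(1)])
    fix a
    have "to_fract \<Delta> * N (\<Sum>i\<in>I. \<kappa> (a i) \<star> w i) =
        (\<Sum>\<tau>\<in>?T. (to_fract \<Delta> * c \<tau>) * to_fract (\<Prod>k=0..<n. a (\<tau> k)))"
      by (simp add: N sum_distrib_left to_fract_prod mult_ac)
    also have "\<dots> = to_fract (\<Sum>\<tau>\<in>?T. v \<tau> * (\<Prod>k=0..<n. a (\<tau> k)))"
      by (simp add: \<Delta>(2) to_fract_sum)
    finally show "to_fract \<Delta> * N (\<Sum>i\<in>I. \<kappa> (a i) \<star> w i) =
        to_fract (\<Sum>\<tau>\<in>?T. v \<tau> * (\<Prod>k=0..<n. a (\<tau> k)))" .
  next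
    have "(\<lambda>k\<in>{0..<n}. i0) \<in> ?T"
      using i0 by auto
    from \<Delta>(2)[OF this] show "v (\<lambda>k\<in>{0..<n}. i0) = \<Delta>"
      by (simp add: c_1)
  qed
qed

text \<open>The extra index \<open>None\<close> carries the dominant part \<open>\<kappa> u\<close>,
  the generators in \<open>W\<close> carry \<open>z\<close>. Every term other than
  \<open>\<Delta> * u ^ n\<close> has at least one of its \<open>n\<close> factors from
  \<open>z\<close>, which trades a degree \<open>E * k\<close> for \<open>l\<close>.
  \<open>K\<close> absorbs the degrees of the fixed coefficients. Degrees are multiplied by
  \<open>E\<close>, that is measured in \<open>t\<close>, to avoid fractions.\<close>

lemma N_bounded_expansion:
  obtains \<Delta> K where "\<Delta> \<noteq> 0"
    "\<And>f. \<exists>v. to_fract \<Delta> * N f = to_fract v"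
    "\<And>u z k l. degree u \<le> k \<Longrightarrow> degree z \<le> l \<Longrightarrow> l \<le> E * k \<Longrightarrow>
      \<exists>v. to_fract \<Delta> * N (\<kappa> u + z) = to_fract (\<Delta> * u ^ n + v) \<and>
        E * degree v + E * k \<le> K + E * (n * k) + l"
proof -
  obtain W where W: "finite W"
    "\<And>f k. degree f \<le> k \<Longrightarrow> \<exists>u. f = (\<Sum>w\<in>W. \<kappa> (u w) \<star> w) \<and> (\<forall>w. E * degree (u w) \<le> k)"
    using finite_generators by blast
  \<comment> \<open>The option type keeps the index of \<open>1\<close> apart even if
    \<open>[:1:]\<close> also occurs in \<open>W\<close>.\<close>
  define I where "I = insert None (Some ` W)"
  define w where "w i = (case i of None \<Rightarrow> [:1:] | Some b \<Rightarrow> b)" for i :: "'a poly option"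
  have I: "finite I" "None \<in> I" "w None = [:1:]"
    using W by (simp_all add: I_def w_def)
  let ?T = "{0..<n} \<rightarrow>\<^sub>E I" and ?\<tau> = "\<lambda>k\<in>{0..<n}. None"
  obtain \<Delta> v where \<Delta>: "\<Delta> \<noteq> 0"
    "\<And>a. to_fract \<Delta> * N (\<Sum>i\<in>I. \<kappa> (a i) \<star> w i) =
      to_fract (\<Sum>\<tau>\<in>?T. v \<tau> * (\<Prod>k=0..<n. a (\<tau> k)))" "v ?\<tau> = \<Delta>"
    using N_expansion[of I None w] I by blast
  have T: "finite ?T" "?\<tau> \<in> ?T"
    using I by (auto intro: finite_PiE)
  define K where "K = E * (\<Sum>\<tau>\<in>?T. degree (v \<tau>))"
  have expand: "to_fract \<Delta> * N (\<kappa> u + (\<Sum>b\<in>W. \<kappa> (a b) \<star> b)) =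
      to_fract (\<Sum>\<tau>\<in>?T. v \<tau> * (\<Prod>k=0..<n. case \<tau> k of None \<Rightarrow> u | Some b \<Rightarrow> a b))" for u a
  proof -
    let ?a = "\<lambda>i. case i of None \<Rightarrow> u | Some b \<Rightarrow> a b"
    have "(\<Sum>i\<in>I. \<kappa> (?a i) \<star> w i) = \<kappa> u + (\<Sum>b\<in>W. \<kappa> (a b) \<star> b)"
      using W(1) by (simp add: I_def w_def sum.reindex image_iff)
    then show ?thesis
      using \<Delta>(2)[of ?a] by simp
  qed
  have 1: "\<exists>v. to_fract \<Delta> * N f = to_fract v" for f
  proof -
    obtain a where "f = (\<Sum>b\<in>W. \<kappa> (a b) \<star> b)"
      using W(2)[of f "degree f"] by auto
    then show ?thesis
      using expand[of 0 a] by (simp only: \<kappa>_0 add_0) blast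
  qed
  have 2: "\<exists>v. to_fract \<Delta> * N (\<kappa> u + z) = to_fract (\<Delta> * u ^ n + v) \<and>
        E * degree v + E * k \<le> K + E * (n * k) + l"
    if *: "degree u \<le> k" "degree z \<le> l" "l \<le> E * k" for u z k l
  proof -
    obtain a where a: "z = (\<Sum>b\<in>W. \<kappa> (a b) \<star> b)" "\<And>b. E * degree (a b) \<le> l"
      using W(2)[OF *(2)] by blast
    let ?a = "\<lambda>i. case i of None \<Rightarrow> u | Some b \<Rightarrow> a b"
    let ?m = "\<lambda>\<tau>. v \<tau> * (\<Prod>k=0..<n. ?a (\<tau> k))"
    have \<tau>_term: "?m ?\<tau> = \<Delta> * u ^ n"
      by (simp add: \<Delta>(3))
    define y where "y = (\<Sum>\<tau>\<in>?T - {?\<tau>}. ?m \<tau>)"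
    have deg_a: "E * degree (?a i) \<le> E * k" for i
    proof (cases i)
      case (Some b)
      then show ?thesis
        using order_trans[OF a(2)[of b] *(3)] by simp
    qed (use *(1) in simp)
    have "E * degree (?m \<tau>) + E * k \<le> K + E * (n * k) + l" if \<tau>: "\<tau> \<in> ?T - {?\<tau>}" for \<tau>
    proof -
      have "\<exists>j\<in>{0..<n}. \<tau> j \<noteq> None"
      proof (rule ccontr)
        assume "\<not> ?thesis"
        then have "\<tau> = ?\<tau>"
          using \<tau> by (intro ext) (auto simp: PiE_def extensional_def restrict_def)
        then show False
          using \<tau> by simp
      qed
      then obtain j b where j: "j \<in> {0..<n}" "\<tau> j = Some b"
        by auto
      have "degree (\<Prod>k=0..<n. ?a (\<tau> k)) \<le> (\<Sum>k=0..<n. degree (?a (\<tau> k)))"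
        using degree_prod_sum_le[of "{0..<n}" "\<lambda>k. ?a (\<tau> k)"] by (simp add: o_def)
      then have "E * degree (\<Prod>k=0..<n. ?a (\<tau> k)) \<le> (\<Sum>k=0..<n. E * degree (?a (\<tau> k)))"
        unfolding sum_distrib_left[symmetric] by (rule mult_le_mono2)
      also have "\<dots> = E * degree (?a (\<tau> j)) + (\<Sum>k\<in>{0..<n} - {j}. E * degree (?a (\<tau> k)))"
        using j by (intro sum.remove) auto
      also have "\<dots> \<le> l + (\<Sum>k'\<in>{0..<n} - {j}. E * k)"
        using j a(2) deg_a by (intro add_mono sum_mono) auto
      finally have "E * degree (\<Prod>k=0..<n. ?a (\<tau> k)) \<le> l + (\<Sum>k'\<in>{0..<n} - {j}. E * k)" .
      moreover have "(\<Sum>k'\<in>{0..<n} - {j}. E * k) + E * k = E * (n * k)"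
        using j by (cases n) (simp_all add: algebra_simps)
      ultimately have prod: "E * degree (\<Prod>k=0..<n. ?a (\<tau> k)) + E * k \<le> l + E * (n * k)"
        by linarith
      have "degree (v \<tau>) \<le> (\<Sum>\<tau>\<in>?T. degree (v \<tau>))"
        using \<tau> T by (intro member_le_sum) auto
      then have "E * degree (v \<tau>) \<le> K"
        unfolding K_def by (rule mult_le_mono2)
      moreover have "E * degree (?m \<tau>) \<le> E * degree (v \<tau>) + E * degree (\<Prod>k=0..<n. ?a (\<tau> k))"
        unfolding distrib_left[symmetric] by (rule mult_le_mono2) (rule degree_mult_le)
      ultimately show ?thesis
        using prod by linarith
    qed
    note bound = this
    define D where "D = (K + E * (n * k) + l - E * k) div E"
    have "degree (?m \<tau>) \<le> D" if "\<tau> \<in> ?T - {?\<tau>}" for \<tau>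
      using bound[OF that] E_pos by (simp add: D_def less_eq_div_iff_mult_less_eq mult.commute)
    then have "degree y \<le> D"
      unfolding y_def using T by (intro degree_sum_le) auto
    then have "E * degree y \<le> K + E * (n * k) + l - E * k"
      using E_pos by (simp add: D_def less_eq_div_iff_mult_less_eq mult.commute)
    \<comment> \<open>Positivity of \<open>n\<close> makes the truncated difference in
      \<open>D\<close> exact.\<close>
    moreover have "E * k \<le> E * (n * k)"
      using n_def d_pos E_pos by simp
    ultimately have "E * degree y + E * k \<le> K + E * (n * k) + l"
      by linarith
    moreover have "(\<Sum>\<tau>\<in>?T. ?m \<tau>) = \<Delta> * u ^ n + y"
      unfolding y_def \<tau>_term[symmetric] using T by (rule sum.remove)
    ultimately show ?thesis
      using expand[of u a] a(1) by auto
  qed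
  show thesis
    using that[OF \<Delta>(1) 1 2] by blast
qed

lemma N_integral: "\<exists>u. N f = to_fract u"
proof -
  obtain \<Delta> where \<Delta>: "\<Delta> \<noteq> 0" "\<And>f. \<exists>v. to_fract \<Delta> * N f = to_fract v"
    using N_bounded_expansion by metis
  show ?thesis
  proof (rule fract_integral[OF \<Delta>(1)])
    show "\<exists>v. to_fract \<Delta> * N f ^ s = to_fract v" for s
      using \<Delta>(2)[of "f \<up> s"] by (simp add: N_power)
  qed
qed

definition nrd :: "'a poly \<Rightarrow> 'f poly"
  where "nrd f = (THE u. N f = to_fract u)"

lemma N_eq: "N f = to_fract (nrd f)"
proof -
  have "\<exists>!u. N f = to_fract u"
    using N_integral[of f] by auto
  then show ?thesis
    unfolding nrd_def by (rule theI')
qed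

lemma nrd_mult: "nrd (f \<star> q) = nrd f * nrd q"
  using N_mult[of f q] by (simp add: N_eq flip: to_fract_mult)

lemma nrd_\<kappa>: "nrd (\<kappa> u) = u ^ n"
  using N_\<kappa>[of u] by (simp add: N_eq)

lemma nrd_1: "nrd [:1:] = 1"
  using nrd_\<kappa>[of 1] by simp

lemma nrd_power: "nrd (f \<up> s) = nrd f ^ s"
  by (induction s) (simp_all add: nrd_1 nrd_mult)

text \<open>Frobenius is injective on a field of characteristic \<open>p\<close>.\<close>

lemma p_power_root_of_1:
  fixes c :: 'f
  assumes "c ^ (p ^ k) = 1"
  shows "c = 1"
proof -
  have "(c - 1 + 1) ^ (p ^ k) = (c - 1) ^ (p ^ k) + 1 ^ (p ^ k)"
    by (rule freshmans_dream') (use prime_p char_f in auto)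
  then have "(c - 1) ^ (p ^ k) = 0"
    using assms by simp
  then show ?thesis
    by simp
qed

text \<open>For monic \<open>f\<close> of degree \<open>m\<close> the power \<open>f\<^sup>E\<close> differs from the central element \<open>x\<^sup>m\<close> by some
  \<open>z\<close> of smaller degree. By Frobenius, passing to \<open>Q\<close>-th powers with \<open>Q = p\<^sup>s\<close> large makes the gap
  between \<open>x\<^bsup>mQ\<^esup>\<close> and \<open>z\<^sup>Q\<close> exceed any constant.\<close>

lemma monic_nrd:
  assumes f: "lead_coeff f = 1" "degree f = m"
  shows "lead_coeff (nrd f) = 1" "degree (nrd f) = d * m"
proof -
  have *: "lead_coeff (nrd f) = 1 \<and> degree (nrd f) = d * m" if "m > 0"
  proof -
    obtain \<Delta> K where \<Delta>: "\<Delta> \<noteq> 0"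
      "\<And>u z k l. degree u \<le> k \<Longrightarrow> degree z \<le> l \<Longrightarrow> l \<le> E * k \<Longrightarrow>
        \<exists>v. to_fract \<Delta> * N (\<kappa> u + z) = to_fract (\<Delta> * u ^ n + v) \<and>
          E * degree v + E * k \<le> K + E * (n * k) + l"
      using N_bounded_expansion by metis
    \<comment> \<open>\<open>K\<close> is the constant that the gap has to beat, and
      \<open>p ^ Suc K\<close> exceeds it; \<open>Q\<close> is a power of \<open>p\<close> for the
      sake of Frobenius.\<close>
    define s Q where "s = Suc K" and "Q = p ^ s"
    have "K < Q"
      using power_gt_expt[of p s] prime_gt_1_nat[OF prime_p] by (simp add: s_def Q_def)
    let ?X = "monom 1 m :: 'f poly"
    define z where "z = f \<up> E - \<kappa> ?X"
    have "degree z \<le> E * m - 1"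
    proof (rule degree_le, intro allI impI)
      fix i assume "i > E * m - 1"
      then have "i = E * m \<or> i > E * m"
        by auto
      moreover have deg: "degree (f \<up> E) = E * m"
        using f by (simp add: degree_skew_power)
      moreover have "coeff (f \<up> E) (E * m) = 1"
        using lead_coeff_skew_power[OF f(1), of E] unfolding deg .
      moreover have "degree (\<kappa> ?X) = E * m"
        by (simp add: degree_monom_eq)
      moreover have "coeff (\<kappa> ?X) (E * m) = 1"
        using coeff_\<kappa>[of ?X m] by (simp add: degree_monom_eq)
      ultimately show "coeff z i = 0"
        by (auto simp: z_def coeff_eq_0)
    qed
    then have z: "degree (z \<up> Q) \<le> Q * (E * m - 1)"
      by (simp add: degree_skew_power)
    have "f \<up> (E * Q) = \<kappa> ?X \<up> Q + z \<up> Q"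
      unfolding skew_power_mult Q_def using skew_freshmans_dream[OF central_hom_\<kappa> prime_p, of ?X z s] char_f
      by (simp add: z_def)
    then have fEQ: "f \<up> (E * Q) = \<kappa> (?X ^ Q) + z \<up> Q"
      by (simp add: \<kappa>_power)
    have X: "?X ^ Q = monom 1 (m * Q)"
      by (simp add: monom_power)
    have "E * m > 0"
      using E_pos that by simp
    then have "Q * (E * m - 1) + Q = Q * (E * m)"
      by (metis Suc_diff_1 mult_Suc_right add.commute)
    \<comment> \<open>\<open>z\<close> loses at least one degree in \<open>t\<close> against
      \<open>x^m\<close>, so \<open>z \<up> Q\<close> loses at least \<open>Q\<close>.\<close>
    then have gap: "Q * (E * m - 1) + Q = E * (m * Q)"
      by (simp add: mult_ac)
    obtain v where v: "to_fract \<Delta> * N (f \<up> (E * Q)) = to_fract (\<Delta> * (?X ^ Q) ^ n + v)"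
      "E * degree v + E * (m * Q) \<le> K + E * (n * (m * Q)) + Q * (E * m - 1)"
      using \<Delta>(2)[of "?X ^ Q" "m * Q" "z \<up> Q" "Q * (E * m - 1)"] z gap
      unfolding fEQ X by (auto simp: degree_monom_eq)
    have "to_fract (\<Delta> * nrd f ^ (E * Q)) = to_fract (\<Delta> * (?X ^ Q) ^ n + v)"
      using v(1) by (simp add: N_eq nrd_power)
    \<comment> \<open>Since \<open>v\<close> has smaller degree than the dominant term, this
      identity determines the degree of \<open>nrd f\<close> and the \<open>E * Q\<close>-th power
      of its leading coefficient; \<open>E * Q\<close> is a power of \<open>p\<close>.\<close>
    then have eq: "\<Delta> * nrd f ^ (E * Q) = \<Delta> * monom 1 (m * Q * n) + v"
      unfolding to_fract_eq_iff by (simp add: X monom_power)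
    have deg_main: "degree (\<Delta> * monom 1 (m * Q * n)) = degree \<Delta> + m * Q * n"
      using \<Delta>(1) by (simp add: degree_mult_eq degree_monom_eq)
    have "lead_coeff (\<Delta> * monom 1 (m * Q * n)) = lead_coeff \<Delta>"
      unfolding lead_coeff_mult by (simp add: degree_monom_eq)
    note main = deg_main this
    have "E * degree v < E * (n * (m * Q))"
      using v(2) gap \<open>K < Q\<close> by linarith
    then have lt: "degree v < degree (\<Delta> * monom 1 (m * Q * n))"
      unfolding main by (simp add: mult_ac trans_less_add2)
    have "degree (\<Delta> * nrd f ^ (E * Q)) = degree \<Delta> + m * Q * n"
      unfolding eq using degree_add_eq_left[OF lt] main by simp
    moreover have lc: "lead_coeff (\<Delta> * nrd f ^ (E * Q)) = lead_coeff \<Delta>"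
      unfolding eq using lead_coeff_add_le[OF lt] main by (simp add: add.commute)
    then have "lead_coeff (nrd f) ^ (E * Q) = 1"
      using \<Delta>(1) by (simp add: lead_coeff_mult lead_coeff_power)
    then have "lead_coeff (nrd f) ^ (p ^ (e + s)) = 1"
      by (simp add: E_def Q_def power_add)
    then have "lead_coeff (nrd f) = 1"
      by (rule p_power_root_of_1)
    moreover have "E * Q * degree (nrd f) = m * Q * n"
      using calculation \<Delta>(1) by (subst (asm) degree_mult_eq) (auto simp: degree_power_eq')
    then have "(E * Q) * degree (nrd f) = (E * Q) * (d * m)"
      by (simp add: n_def mult_ac)
    then have "degree (nrd f) = d * m"
      using E_pos \<open>K < Q\<close> by simp
    ultimately show ?thesis
      by blast
  qed
  have "f = [:1:]" if "m = 0"
    using f that by (metis degree_eq_zeroE coeff_pCons_0 degree_pCons_0)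
  then show "lead_coeff (nrd f) = 1" "degree (nrd f) = d * m"
    using * by (cases "m = 0", auto simp: nrd_1)+
qed

end

subsection \<open>Factorizations and the reduced norm\<close>

lemma irreducible_dvd_power_imp_dvd:
  fixes q u :: "'f::field poly"
  assumes "irreducible q" "q dvd u ^ k"
  shows "q dvd u"
  using field_poly_irreducible_imp_prime[OF assms(1)] assms(2) by (rule prime_elem_dvd_power)

lemma irreducible_dvd_irreducible:
  "irreducible q \<Longrightarrow> irreducible u \<Longrightarrow> q dvd u \<Longrightarrow> u dvd q"
  by (auto dest: irreducibleD' simp: irreducible_not_unit)

lemma monic_poly_degree_0:
  fixes c :: "'f::field poly"
  shows "lead_coeff c = 1 \<Longrightarrow> degree c = 0 \<Longrightarrow> c = 1"
  by (metis degree_eq_zeroE coeff_pCons_0 degree_pCons_0 one_pCons)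

lemma monic_dvd_antisym:
  fixes q u :: "'f::field poly"
  assumes "q dvd u" "u dvd q" "lead_coeff q = 1" "lead_coeff u = 1"
  shows "q = u"
proof -
  obtain c where c: "u = q * c"
    using assms(1) by (elim dvdE)
  have "lead_coeff c = 1"
    using assms(3,4) by (simp only: c lead_coeff_mult) simp
  moreover have "q \<noteq> 0" "u \<noteq> 0"
    using assms(3,4) by auto
  then have "degree q = degree u"
    using assms(1,2) by (intro antisym dvd_imp_degree_le)
  then have "degree c = 0"
    using \<open>u \<noteq> 0\<close> by (simp add: c degree_mult_eq)
  ultimately have "c = 1"
    by (rule monic_poly_degree_0)
  then show ?thesis
    by (simp add: c)
qed

lemma irreducible_dvd_prod_list:
  fixes q :: "'f::field poly"
  assumes "irreducible q" "q dvd prod_list us"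
  shows "\<exists>u\<in>set us. q dvd u"
  using assms(2)
proof (induction us)
  case Nil
  then show ?case
    using assms(1) by (simp add: irreducible_not_unit)
next
  case (Cons u us)
  then have "q dvd u \<or> q dvd prod_list us"
    using field_poly_irreducible_imp_prime[OF assms(1)] by (simp add: prime_elem_dvd_mult_iff)
  then show ?case
    using Cons.IH by auto
qed

text \<open>Associated monic polynomials are equal, so an irreducible factor of multiplicity two
  would have to occur twice in the list.\<close>

lemma distinct_irreducible_prod_squarefree:
  fixes q :: "'f::field poly"
  assumes us: "\<And>u. u \<in> set us \<Longrightarrow> irreducible u \<and> lead_coeff u = 1" "distinct us"
    and q: "irreducible q"
  shows "\<not> q * q dvd prod_list us"
proof
  assume qq: "q * q dvd prod_list us"
  then have "q dvd prod_list us"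
    by (rule dvd_mult_left)
  then obtain u where u: "u \<in> set us" "q dvd u"
    using irreducible_dvd_prod_list q by blast
  then have uq: "u dvd q"
    using us(1) q irreducible_dvd_irreducible by blast
  obtain as bs where split: "us = as @ u # bs"
    using u(1) by (meson split_list)
  have "u * u dvd u * prod_list (as @ bs)"
    using dvd_trans[OF mult_dvd_mono[OF uq uq] qq] by (simp add: split mult.left_commute)
  moreover have "u \<noteq> 0"
    using us(1)[OF u(1)] by auto
  ultimately have "u dvd prod_list (as @ bs)"
    by (auto simp only: dvd_mult_cancel_left)
  then obtain u' where u': "u' \<in> set (as @ bs)" "u dvd u'"
    using irreducible_dvd_prod_list us(1)[OF u(1)] by blast
  have "u' \<in> set us"
    using u'(1) by (auto simp: split)
  then have "u = u'"
    using us(1)[OF u(1)] us(1)[of u'] u'(2) irreducible_dvd_irreducible[of u u'] monic_dvd_antisym[of u u']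
    by blast
  then show False
    using us(2) u'(1) by (auto simp: split)
qed

context skew_polynomials
begin

lemma units_R: "f \<in> Units R \<longleftrightarrow> f \<noteq> 0 \<and> degree f = 0"
proof
  assume "f \<in> Units R"
  then obtain y where y: "f \<star> y = [:1:]"
    by (auto simp: Units_def)
  then have "f \<noteq> 0" "y \<noteq> 0"
    by auto
  then show "f \<noteq> 0 \<and> degree f = 0"
    using degree_skew[of f y] y by simp
next
  assume "f \<noteq> 0 \<and> degree f = 0"
  then obtain a where "f = [:a:]" "a \<noteq> 0"
    by (metis degree_eq_zeroE pCons_0_0)
  then show "f \<in> Units R"
    by (auto simp: Units_def skew_const_const intro!: exI[of _ "[:inverse a:]"])
qed

lemma skew_irreducible_iff:
  "f \<noteq> 0 \<Longrightarrow> skew_irreducible \<delta> f \<longleftrightarrow> degree f > 0 \<and>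
    (\<forall>q r. f = q \<star> r \<longrightarrow> degree q = 0 \<or> degree r = 0)"
proof -
  assume "f \<noteq> 0"
  have "(1 \<le> degree q \<and> degree q < degree f \<and> 1 \<le> degree r \<and> degree r < degree f) \<longleftrightarrow>
      degree q \<noteq> 0 \<and> degree r \<noteq> 0" if "f = q \<star> r" for q r
  proof -
    have "degree f = degree q + degree r"
      using that \<open>f \<noteq> 0\<close> by (auto simp: degree_skew)
    then show ?thesis
      by auto
  qed
  then show ?thesis
    unfolding skew_irreducible_def mult_R units_R using \<open>f \<noteq> 0\<close> by (metis neq0_conv)
qed

lemma skew_prod_Nil [simp]: "skew_prod \<delta> [] = [:1:]"
  and skew_prod_Cons [simp]: "skew_prod \<delta> (q # qs) = q \<star> skew_prod \<delta> qs"
  by (simp_all add: skew_prod_def)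

lemma skew_prod_append [simp]: "skew_prod \<delta> (qs @ rs) = skew_prod \<delta> qs \<star> skew_prod \<delta> rs"
  by (induction qs) (simp_all add: skew_assoc)

lemma monic_degree_0: "lead_coeff q = 1 \<Longrightarrow> degree q = 0 \<Longrightarrow> q = [:1:]"
  by (metis degree_eq_zeroE coeff_pCons_0 degree_pCons_0)

end

section \<open>Central multiples and the norm\<close>

context skew_norm
begin

text \<open>Scaling makes \<open>f\<close> monic; the constant split off is invertible in
  \<open>R\<close>, so its norm is a unit of \<open>F[x]\<close>.\<close>

lemma nrd_nonzero: "f \<noteq> 0 \<Longrightarrow> nrd f \<noteq> 0"
  and degree_nrd: "f \<noteq> 0 \<Longrightarrow> degree (nrd f) = d * degree f"
proof -
  assume f: "f \<noteq> 0"
  let ?a = "lead_coeff f"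
  define f' where "f' = [:inverse ?a:] \<star> f"
  have "lead_coeff f' = 1"
    using f by (simp add: f'_def lead_coeff_skew)
  moreover have "degree f' = degree f"
    using f by (simp add: f'_def degree_skew)
  ultimately have f': "lead_coeff (nrd f') = 1" "degree (nrd f') = d * degree f"
    using monic_nrd[of f' "degree f"] by auto
  have "nrd [:?a:] * nrd [:inverse ?a:] = 1"
    using f by (simp add: skew_const_const nrd_1 flip: nrd_mult)
  then have "nrd [:?a:] dvd 1"
    by (metis dvd_triv_left)
  moreover from this have "nrd [:?a:] \<noteq> 0"
    by (metis dvd_0_left_iff zero_neq_one)
  ultimately have unit: "nrd [:?a:] \<noteq> 0" "degree (nrd [:?a:]) = 0"
    by (simp_all add: is_unit_iff_degree)
  have "f = [:?a:] \<star> f'"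
    using f by (simp add: f'_def skew_const_const flip: skew_assoc)
  then have nrd: "nrd f = nrd [:?a:] * nrd f'"
    using nrd_mult by metis
  moreover have "nrd f' \<noteq> 0"
    using f'(1) by auto
  ultimately show "nrd f \<noteq> 0" "degree (nrd f) = d * degree f"
    using unit f'(2) by (simp_all add: degree_mult_eq)
qed

lemma nrd_unit_iff: "f \<noteq> 0 \<Longrightarrow> nrd f dvd 1 \<longleftrightarrow> degree f = 0"
  using nrd_nonzero[of f] degree_nrd[of f] d_pos by (simp add: is_unit_iff_degree)

text \<open>An ideal of \<open>F[x]\<close>, the contraction of the left ideal \<open>R f\<close>
  along \<open>\<kappa>\<close>, with 0 included. For the \<open>f\<close> of the theorem,
  \<open>hhat\<close> is its monic generator.\<close>

definition central_multiples :: "'a poly \<Rightarrow> 'f poly set"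
  where "central_multiples f = {u. \<exists>q. \<kappa> u = q \<star> f}"

lemma central_multiples_diff:
  "u \<in> central_multiples f \<Longrightarrow> v \<in> central_multiples f \<Longrightarrow> u - v \<in> central_multiples f"
  unfolding central_multiples_def by (auto simp: \<kappa>_diff simp flip: skew_diff_left)

lemma central_multiples_mult:
  "u \<in> central_multiples f \<Longrightarrow> v * u \<in> central_multiples f"
  unfolding central_multiples_def by (auto simp: \<kappa>_mult simp flip: skew_assoc)

lemma central_multiples_dvd:
  "u \<in> central_multiples f \<Longrightarrow> u dvd v \<Longrightarrow> v \<in> central_multiples f"
  by (metis central_multiples_mult dvdE mult.commute)

lemma central_multiples_right_factor:
  "u \<in> central_multiples (f \<star> q) \<Longrightarrow> u \<in> central_multiples q"
  unfolding central_multiples_def by (auto simp flip: skew_assoc)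

text \<open>Centrality turns the factors around: \<open>\<kappa> u = y \<star> f \<star> q\<close>
  gives \<open>\<kappa> u \<star> q = q \<star> y \<star> f \<star> q\<close>, and \<open>q\<close>
  cancels.\<close>

lemma central_multiples_left_factor:
  assumes "u \<in> central_multiples (f \<star> q)" "q \<noteq> 0"
  shows "u \<in> central_multiples f"
proof -
  obtain y where y: "\<kappa> u = y \<star> (f \<star> q)"
    using assms by (auto simp: central_multiples_def)
  have "\<kappa> u \<star> q = q \<star> (y \<star> (f \<star> q))"
    using \<kappa>_comm[of u q] y by simp
  then have "\<kappa> u \<star> q = ((q \<star> y) \<star> f) \<star> q"
    by (simp only: skew_assoc)
  then have "\<kappa> u = (q \<star> y) \<star> f"
    using assms(2) by (rule skew_cancel_right)
  then show ?thesis
    by (auto simp: central_multiples_def)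
qed

text \<open>Norms are taken on both sides of \<open>\<kappa> u = q \<star> f\<close>. Hence every
  irreducible factor of \<open>nrd f\<close> divides each central multiple.\<close>

lemma nrd_dvd_power: "u \<in> central_multiples f \<Longrightarrow> nrd f dvd u ^ n"
  unfolding central_multiples_def by (auto simp: nrd_mult simp flip: nrd_\<kappa>)

text \<open>\<open>v\<close> is taken of least degree in the ideal. If \<open>v = a * b\<close>, the
  greatest common right divisor of \<open>f\<close> and \<open>\<kappa> a\<close> is trivial or all
  of \<open>f\<close> up to a constant; so \<open>b\<close> or \<open>a\<close> lies in the ideal,
  and the other factor is constant. As \<open>nrd f\<close> is a nonunit dividing
  \<open>v ^ n\<close>, it is divisible by \<open>v\<close>.\<close>

lemma irreducible_central_multiple:
  assumes f: "skew_irreducible \<delta> f" "f \<noteq> 0" and u: "u \<in> central_multiples f" "u \<noteq> 0"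
  shows "\<exists>v. irreducible v \<and> v \<in> central_multiples f \<and> v dvd nrd f"
proof -
  have deg_f: "degree f > 0" and fact: "\<And>q r. f = q \<star> r \<Longrightarrow> degree q = 0 \<or> degree r = 0"
    using f skew_irreducible_iff by auto
  obtain v where v: "v \<in> central_multiples f" "v \<noteq> 0"
    and min: "\<And>w. w \<in> central_multiples f \<Longrightarrow> w \<noteq> 0 \<Longrightarrow> degree v \<le> degree w"
    using ex_has_least_nat[of "\<lambda>u. u \<in> central_multiples f \<and> u \<noteq> 0" u degree] u by blast
  have "irreducible v"
  proof (rule irreducibleI)
    show "\<not> v dvd 1"
    proof
      assume "v dvd 1"
      then have "1 \<in> central_multiples f"
        using v(1) central_multiples_dvd by blast
      then obtain q where q: "[:1:] = q \<star> f"
        by (auto simp: central_multiples_def)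
      then have "q \<noteq> 0"
        by auto
      moreover have "degree (q \<star> f) = 0"
        by (simp flip: q)
      ultimately show False
        using degree_skew[of q f] f(2) deg_f by simp
    qed
  next
    fix a b assume ab: "v = a * b"
    then have ab0: "a \<noteq> 0" "b \<noteq> 0"
      using v(2) by auto
    obtain h s t y z where h: "lead_coeff h = 1" "h = s \<star> f + t \<star> \<kappa> a" "f = y \<star> h" "\<kappa> a = z \<star> h"
      using skew_gcrd[OF f(2)] by blast
    show "a dvd 1 \<or> b dvd 1"
    proof (cases "degree h = 0")
      case True
      \<comment> \<open>Multiplied by \<open>\<kappa> b\<close>, the Bezout identity contains
        \<open>\<kappa> v\<close> in place of \<open>\<kappa> a\<close>, which is a left multiple of
        \<open>f\<close>.\<close>
      then have one: "[:1:] = s \<star> f + t \<star> \<kappa> a"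
        using monic_degree_0[OF h(1)] h(2) by simp
      obtain q where q: "\<kappa> v = q \<star> f"
        using v(1) by (auto simp: central_multiples_def)
      have "\<kappa> b = s \<star> f \<star> \<kappa> b + t \<star> \<kappa> a \<star> \<kappa> b"
        using arg_cong[OF one, of "\<lambda>q. q \<star> \<kappa> b"] by (simp add: skew_add_left)
      also have "s \<star> f \<star> \<kappa> b = (s \<star> \<kappa> b) \<star> f"
        by (simp only: skew_assoc \<kappa>_comm[of b f])
      also have "t \<star> \<kappa> a \<star> \<kappa> b = (t \<star> q) \<star> f"
        by (simp only: skew_assoc q[symmetric] ab \<kappa>_mult)
      finally have "\<kappa> b = (s \<star> \<kappa> b + t \<star> q) \<star> f"
        by (simp only: skew_add_left)
      then have "b \<in> central_multiples f"
        unfolding central_multiples_def by blast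
      then have "degree v \<le> degree b"
        using min ab0 by blast
      then show ?thesis
        using ab0 by (simp add: ab degree_mult_eq is_unit_iff_degree)
    next
      case False
      then have "degree y = 0" "y \<noteq> 0"
        using fact[OF h(3)] f(2) h(3) by auto
      then obtain c where "y = [:c:]" "c \<noteq> 0"
        by (metis degree_eq_zeroE pCons_0_0)
      then have "\<kappa> a = (z \<star> [:inverse c:]) \<star> f"
        unfolding h(3) h(4) by (simp add: skew_assoc skew_const_const flip: skew_assoc[of _ "[:c:]"])
      then have "a \<in> central_multiples f"
        unfolding central_multiples_def by blast
      then have "degree v \<le> degree a"
        using min ab0 by blast
      then show ?thesis
        using ab0 by (simp add: ab degree_mult_eq is_unit_iff_degree)
    qed
  qed (use v in simp)
  moreover have "v dvd nrd f"
  proof -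
    have "nrd f \<noteq> 0" "\<not> nrd f dvd 1"
      using f(2) deg_f by (simp_all add: nrd_nonzero nrd_unit_iff)
    then obtain q where q: "irreducible q" "q dvd nrd f"
      using poly_exists_irreducible_factor by blast
    then have "q dvd v ^ n"
      using nrd_dvd_power[OF v(1)] dvd_trans by blast
    then have "q dvd v"
      using q(1) irreducible_dvd_power_imp_dvd by blast
    then have "v dvd q"
      using q(1) \<open>irreducible v\<close> irreducible_dvd_irreducible by blast
    then show ?thesis
      using q(2) dvd_trans by blast
  qed
  ultimately show ?thesis
    using v(1) by blast
qed

text \<open>Induction over factorizations \<open>f = q \<star> r\<close>, based on the irreducible
  case. Writing \<open>\<kappa> (nrd r) = z \<star> r\<close>, the central element
  \<open>\<kappa> (nrd q)\<close> is moved past \<open>z\<close> to meet \<open>r\<close>, where it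
  becomes a left multiple of \<open>q \<star> r\<close>. The given \<open>u\<close> supplies a
  nonzero central multiple for both factors.\<close>

lemma nrd_central_multiple:
  assumes "f \<noteq> 0" "u \<in> central_multiples f" "u \<noteq> 0"
  shows "nrd f \<in> central_multiples f"
  using assms
proof (induction "degree f" arbitrary: f rule: less_induct)
  case less
  show ?case
  proof (cases "degree f = 0")
    case True
    then obtain a where "f = [:a:]" "a \<noteq> 0"
      using less.prems(1) by (metis degree_eq_zeroE pCons_0_0)
    then have "\<kappa> (nrd f) = (\<kappa> (nrd f) \<star> [:inverse a:]) \<star> f"
      by (simp add: skew_assoc skew_const_const)
    then show ?thesis
      unfolding central_multiples_def by blast
  next
    case False
    show ?thesis
    proof (cases "skew_irreducible \<delta> f")
      case True
      then show ?thesis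
        using irreducible_central_multiple less.prems central_multiples_dvd by blast
    next
      case reducible: False
      then obtain q r where qr: "f = q \<star> r" "degree q \<noteq> 0" "degree r \<noteq> 0"
        using skew_irreducible_iff[OF less.prems(1)] False by auto
      then have ne: "q \<noteq> 0" "r \<noteq> 0"
        using less.prems(1) by auto
      then have "degree f = degree q + degree r"
        using qr(1) by (simp add: degree_skew)
      then have smaller: "degree q < degree f" "degree r < degree f"
        using qr by simp_all
      have "u \<in> central_multiples q" "u \<in> central_multiples r"
        using less.prems(2) central_multiples_left_factor[OF _ ne(2)] central_multiples_right_factor
        unfolding qr(1) by blast+
      then have "nrd q \<in> central_multiples q" "nrd r \<in> central_multiples r"
        using less.hyps[OF smaller(1) ne(1)] less.hyps[OF smaller(2) ne(2)] less.prems(3) by blast+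
      then obtain y z where yz: "\<kappa> (nrd q) = y \<star> q" "\<kappa> (nrd r) = z \<star> r"
        by (auto simp: central_multiples_def)
      have "\<kappa> (nrd f) = \<kappa> (nrd q) \<star> (z \<star> r)"
        by (simp add: qr(1) nrd_mult \<kappa>_mult yz(2))
      also have "\<dots> = z \<star> (\<kappa> (nrd q) \<star> r)"
        by (simp only: skew_assoc[symmetric] \<kappa>_comm[of _ z])
      also have "\<dots> = (z \<star> y) \<star> f"
        by (simp only: yz(1) qr(1) skew_assoc)
      finally show ?thesis
        unfolding central_multiples_def by blast
    qed
  qed
qed

text \<open>By \<open>nrd_minimalI\<close> below, the hypothesis that the minimal central left multiple of \<open>f\<close> has
  degree \<open>d m\<close> in \<open>x\<close> says that it is the reduced norm. The point of this reformulation is that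
  it passes to left factors.\<close>

definition nrd_minimal :: "'a poly \<Rightarrow> bool"
  where "nrd_minimal f \<longleftrightarrow> lead_coeff f = 1 \<and> nrd f \<in> central_multiples f \<and>
    (\<forall>u \<in> central_multiples f. nrd f dvd u)"

text \<open>Division with remainder makes \<open>h\<close> a generator of the ideal of central
  multiples. That ideal contains \<open>nrd f\<close>, which is monic of the same degree
  \<open>d * m\<close>, so the two agree.\<close>

lemma nrd_minimalI:
  assumes f: "lead_coeff f = 1" "degree f = m"
    and h: "h \<in> central_multiples f" "lead_coeff h = 1" "degree h = d * m"
    and min: "\<And>u. u \<in> central_multiples f \<Longrightarrow> u \<noteq> 0 \<Longrightarrow> degree h \<le> degree u"
  shows "nrd_minimal f"
proof -
  have "h \<noteq> 0" "f \<noteq> 0"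
    using h(2) f(1) by auto
  have dvd: "h dvd u" if u: "u \<in> central_multiples f" for u
  proof -
    have "u - (u div h) * h \<in> central_multiples f"
      using u h(1) by (intro central_multiples_diff central_multiples_mult)
    then have "u mod h \<in> central_multiples f"
      by (simp add: minus_div_mult_eq_mod)
    moreover have "u mod h = 0 \<or> degree (u mod h) < degree h"
      using \<open>h \<noteq> 0\<close> by (rule degree_mod_less)
    ultimately have "u mod h = 0"
      using min by force
    then show ?thesis
      by (simp add: dvd_eq_mod_eq_0)
  qed
  have in_f: "nrd f \<in> central_multiples f"
    using nrd_central_multiple[OF \<open>f \<noteq> 0\<close> h(1) \<open>h \<noteq> 0\<close>] .
  then have "h dvd nrd f"
    by (rule dvd)
  moreover have deg: "lead_coeff (nrd f) = 1" "degree (nrd f) = degree h"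
    using monic_nrd[OF f] h(3) by auto
  moreover obtain c where c: "nrd f = h * c"
    using calculation(1) by (elim dvdE)
  have "lead_coeff c = 1"
    using deg(1) h(2) by (simp only: c lead_coeff_mult) simp
  moreover from this have "c \<noteq> 0"
    by auto
  then have "degree c = 0"
    using deg(2) \<open>h \<noteq> 0\<close> by (simp add: c degree_mult_eq)
  ultimately have "c = 1"
    by (intro monic_poly_degree_0)
  then have "nrd f = h"
    using c by simp
  then show ?thesis
    unfolding nrd_minimal_def using f(1) in_f dvd by simp
qed

text \<open>\<open>r\<close> is the greatest common right divisor of \<open>f\<close> and
  \<open>\<kappa> q\<close>. Minimality of \<open>nrd f\<close> enters twice: a central multiple of
  \<open>f'\<close> times \<open>q\<close> is one of \<open>f\<close>, which forces
  \<open>w dvd nrd f'\<close> and so \<open>nrd r dvd q\<close>; and \<open>r\<close> is not 1, as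
  otherwise \<open>w\<close> would be a central multiple of \<open>f\<close>. Irreducibility of
  \<open>q\<close> leaves only a unit between \<open>nrd r\<close> and \<open>q\<close>, which is 1
  because both are monic.\<close>

lemma nrd_minimal_split:
  assumes f: "nrd_minimal f" "nrd f = w * q" and q: "irreducible q" "lead_coeff q = 1"
  shows "\<exists>f' r. f = f' \<star> r \<and> lead_coeff r = 1 \<and> nrd r = q \<and> nrd f' = w \<and> nrd_minimal f' \<and>
    (\<forall>f'' r'. f = f'' \<star> r' \<and> lead_coeff r' = 1 \<and> nrd r' = q \<longrightarrow> r' = r)"
proof -
  have monic_f: "lead_coeff f = 1" and min: "\<And>u. u \<in> central_multiples f \<Longrightarrow> nrd f dvd u"
    and nrd_f: "nrd f \<in> central_multiples f"
    using f(1) by (auto simp: nrd_minimal_def)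
  have "f \<noteq> 0"
    using monic_f by auto
  then have ne: "f \<noteq> 0" "nrd f \<noteq> 0"
    by (simp_all add: nrd_nonzero)
  then have ne': "w \<noteq> 0" "q \<noteq> 0"
    using f(2) by auto
  obtain r s t f' z where r: "lead_coeff r = 1" "r = s \<star> f + t \<star> \<kappa> q" "f = f' \<star> r" "\<kappa> q = z \<star> r"
    using skew_gcrd[OF ne(1)] by blast
  have "lead_coeff f' = 1"
    using r(1,3) monic_f lead_coeff_skew[of f' r] by simp
  then have ne'': "f' \<noteq> 0" "r \<noteq> 0"
    using r(1) by auto
  have w_dvd: "w dvd u" if u: "u \<in> central_multiples f'" for u
  proof -
    obtain y where y: "\<kappa> u = y \<star> f'"
      using u by (auto simp: central_multiples_def)
    have "\<kappa> (u * q) = z \<star> (\<kappa> u \<star> r)"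
      by (simp only: \<kappa>_mult r(4) \<kappa>_comm[of u] skew_assoc)
    also have "\<dots> = (z \<star> y) \<star> f"
      by (simp only: y r(3) skew_assoc)
    finally have "u * q \<in> central_multiples f"
      unfolding central_multiples_def by blast
    then have "w * q dvd u * q"
      using min[of "u * q"] unfolding f(2) by blast
    then show ?thesis
      using ne' by simp
  qed
  have nrd_f': "nrd f' \<in> central_multiples f'"
    using nrd_central_multiple[OF ne''(1) central_multiples_left_factor[of "nrd f" f' r]] nrd_f ne ne'' r(3)
    by simp
  then obtain v where v: "nrd f' = w * v"
    using w_dvd by (auto elim: dvdE)
  have "w * q = w * (v * nrd r)"
    unfolding f(2)[symmetric] by (simp only: r(3) nrd_mult v mult.assoc)
  then have q_eq: "q = v * nrd r"
    using ne'(1) mult_left_cancel by blast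
  have "\<not> nrd r dvd 1"
  proof
    assume "nrd r dvd 1"
    then have "degree r = 0"
      using nrd_unit_iff ne'' by simp
    then have one: "[:1:] = s \<star> f + t \<star> \<kappa> q"
      using monic_degree_0[OF r(1)] r(2) by simp
    obtain y where y: "\<kappa> (w * q) = y \<star> f"
      using nrd_f f(2) by (auto simp: central_multiples_def)
    have "\<kappa> w = s \<star> f \<star> \<kappa> w + t \<star> \<kappa> q \<star> \<kappa> w"
      using arg_cong[OF one, of "\<lambda>q. q \<star> \<kappa> w"] by (simp add: skew_add_left)
    also have "s \<star> f \<star> \<kappa> w = (s \<star> \<kappa> w) \<star> f"
      by (simp only: skew_assoc \<kappa>_comm[of w f])
    also have "t \<star> \<kappa> q \<star> \<kappa> w = (t \<star> y) \<star> f"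
      by (simp only: skew_assoc y[symmetric] \<kappa>_mult[symmetric] mult.commute[of q])
    finally have "\<kappa> w = (s \<star> \<kappa> w + t \<star> y) \<star> f"
      by (simp only: skew_add_left)
    then have "w \<in> central_multiples f"
      unfolding central_multiples_def by blast
    then have "w * q dvd w * 1"
      using min f(2) by simp
    then have "q dvd 1"
      using ne' by (auto simp only: dvd_mult_cancel_left)
    then show False
      using q(1) irreducible_not_unit by blast
  qed
  then have "v dvd 1"
    using q(1) q_eq irreducibleD by blast
  moreover have "v \<noteq> 0"
    using q_eq ne'(2) by auto
  ultimately have "degree v = 0"
    by (simp add: is_unit_iff_degree)
  have "lead_coeff v * lead_coeff (nrd r) = 1"
    using q(2) unfolding q_eq lead_coeff_mult .
  then have "lead_coeff v = 1"
    using monic_nrd(1)[OF r(1) refl] by simp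
  from this \<open>degree v = 0\<close> have "v = 1"
    by (rule monic_poly_degree_0)
  then have res: "nrd r = q" "nrd f' = w"
    using q_eq v by auto
  \<comment> \<open>Its norm \<open>q\<close> is a central multiple of \<open>r'\<close>, so
    \<open>r'\<close> divides both \<open>f\<close> and \<open>\<kappa> q\<close> on the right,
    hence also their combination \<open>r\<close>; equal norms give equal degrees.\<close>
  have "r' = r" if r': "f = f'' \<star> r'" "lead_coeff r' = 1" "nrd r' = q" for f'' r'
  proof -
    have "r' \<noteq> 0"
      using r'(2) by auto
    then have "nrd r' \<in> central_multiples r'"
      using nrd_central_multiple[OF _ central_multiples_right_factor[of "nrd f" f'' r']] nrd_f r'(1) ne by simp
    then obtain y where y: "\<kappa> q = y \<star> r'"
      using r'(3) by (auto simp: central_multiples_def)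
    define c where "c = s \<star> f'' + t \<star> y"
    have c: "r = c \<star> r'"
      unfolding r(2) c_def by (simp add: r'(1) y skew_add_left skew_assoc)
    have "d * degree r = d * degree r'"
      using degree_nrd ne'' \<open>r' \<noteq> 0\<close> r'(3) res(1) by metis
    then have "degree r = degree r'"
      using d_pos by simp
    moreover have "c \<noteq> 0"
      using c ne'' by auto
    ultimately have "degree c = 0"
      using c degree_skew[of c r'] \<open>r' \<noteq> 0\<close> by simp
    moreover have "lead_coeff c = 1"
      using c r(1) r'(2) lead_coeff_skew[of c r'] by simp
    ultimately have "c = [:1:]"
      by (simp add: monic_degree_0)
    then show ?thesis
      using c by simp
  qed
  moreover have "nrd_minimal f'"
    unfolding nrd_minimal_def using \<open>lead_coeff f' = 1\<close> nrd_f' w_dvd res by simp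
  ultimately show ?thesis
    using r(1,3) res by blast
qed

section \<open>Decompositions with prescribed norms\<close>

lemma skew_irreducible_if_nrd:
  assumes "irreducible (nrd q)"
  shows "skew_irreducible \<delta> q"
proof -
  \<comment> \<open>\<open>nrd 0 = 0 ^ n\<close> with \<open>n > 0\<close>, and 0 is not
    irreducible.\<close>
  have "q \<noteq> 0"
    using assms nrd_\<kappa>[of 0] n_def d_pos E_pos by (auto simp: power_0_left)
  moreover have "degree q > 0"
    using assms nrd_unit_iff[OF \<open>q \<noteq> 0\<close>] by (auto simp: irreducible_not_unit)
  moreover have "degree a = 0 \<or> degree b = 0" if ab: "q = a \<star> b" for a b
  proof -
    have "nrd a dvd 1 \<or> nrd b dvd 1"
      using assms nrd_mult[of a b] ab irreducibleD by blast
    moreover have "a \<noteq> 0" "b \<noteq> 0"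
      using ab \<open>q \<noteq> 0\<close> by auto
    ultimately show ?thesis
      by (simp add: nrd_unit_iff)
  qed
  ultimately show ?thesis
    by (simp add: skew_irreducible_iff)
qed

text \<open>Induction from the right end of \<open>hs\<close>: \<open>nrd_minimal_split\<close>
  removes a right factor of prescribed norm, and minimality passes to the left cofactor.\<close>

lemma decomposition_exists:
  assumes "nrd_minimal f" "nrd f = prod_list hs" "\<And>q. q \<in> set hs \<Longrightarrow> irreducible q \<and> lead_coeff q = 1"
  shows "\<exists>fs. fs \<in> irreducible_decompositions \<delta> f \<and> map nrd fs = hs"
  using assms
proof (induction hs arbitrary: f rule: rev_induct)
  case Nil
  then have f: "lead_coeff f = 1" "nrd f dvd 1"
    by (simp_all add: nrd_minimal_def)
  moreover from f have "f \<noteq> 0"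
    by auto
  ultimately have "f = [:1:]"
    by (simp add: nrd_unit_iff monic_degree_0)
  then show ?case
    by (intro exI[of _ "[]"]) (simp add: irreducible_decompositions_def)
next
  case (snoc q hs)
  have nrd_f: "nrd f = prod_list hs * q"
    using snoc.prems by simp
  obtain f' r where r: "f = f' \<star> r" "lead_coeff r = 1" "nrd r = q"
    and f': "nrd f' = prod_list hs" "nrd_minimal f'"
    using nrd_minimal_split[OF snoc.prems(1) nrd_f] snoc.prems(3)[of q] by (auto simp only: set_append list.set)
  obtain fs where fs: "fs \<in> irreducible_decompositions \<delta> f'" "map nrd fs = hs"
    using snoc.IH[OF f'(2,1)] snoc.prems(3) by auto
  have "skew_irreducible \<delta> r"
    using r(3) snoc.prems(3)[of q] by (intro skew_irreducible_if_nrd) simp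
  then show ?case
    using fs r by (intro exI[of _ "fs @ [r]"]) (auto simp: irreducible_decompositions_def)
qed

text \<open>Both last factors are the unique monic right factor of \<open>f\<close> with the given
  norm; cancelling it leaves shorter products for a polynomial that is again minimal.\<close>

lemma decomposition_unique:
  assumes "nrd_minimal f" "skew_prod \<delta> fs = f" "skew_prod \<delta> fs' = f" "map nrd fs = map nrd fs'"
    "\<And>q. q \<in> set fs \<union> set fs' \<Longrightarrow> lead_coeff q = 1" "\<And>q. q \<in> set fs \<Longrightarrow> irreducible (nrd q)"
  shows "fs = fs'"
  using assms
proof (induction fs arbitrary: f fs' rule: rev_induct)
  case (snoc r fs)
  obtain gs r' where fs': "fs' = gs @ [r']"
    using snoc.prems(4) by (cases fs' rule: rev_cases) auto
  have nrd: "nrd r' = nrd r" "map nrd fs = map nrd gs"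
    using snoc.prems(4) by (simp_all add: fs')
  have f: "f = skew_prod \<delta> fs \<star> r" "f = skew_prod \<delta> gs \<star> r'"
    using snoc.prems(2,3) by (auto simp: fs')
  have monic: "lead_coeff r = 1" "lead_coeff r' = 1"
    using snoc.prems(5) by (auto simp: fs')
  have "nrd f = nrd (skew_prod \<delta> fs) * nrd r"
    unfolding f(1) by (rule nrd_mult)
  moreover have "irreducible (nrd r)"
    using snoc.prems(6) by simp
  moreover have "lead_coeff (nrd r) = 1"
    using monic_nrd[OF monic(1) refl] by simp
  ultimately obtain f0 r0 where r0: "f = f0 \<star> r0" "nrd_minimal f0"
    "\<forall>f'' r'. f = f'' \<star> r' \<and> lead_coeff r' = 1 \<and> nrd r' = nrd r \<longrightarrow> r' = r0"
    using nrd_minimal_split[OF snoc.prems(1)] by blast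
  have r: "r = r0" "r' = r0"
    using r0(3) f monic nrd(1) by blast+
  have "r0 \<noteq> 0"
    using r monic by auto
  then have "skew_prod \<delta> fs = f0" "skew_prod \<delta> gs = f0"
    using f r0(1) r skew_cancel_right by metis+
  then have "fs = gs"
    using snoc.IH[OF r0(2)] nrd(2) snoc.prems(5,6) by (auto simp: fs')
  then show ?case
    using r by (simp add: fs')
qed simp

lemma nrd_skew_prod: "nrd (skew_prod \<delta> fs) = prod_list (map nrd fs)"
  by (induction fs) (simp_all add: nrd_1 nrd_mult)

text \<open>As \<open>nrd q dvd v ^ n\<close>, every irreducible factor of \<open>nrd q\<close> is
  associated to the central multiple \<open>v\<close>. A second one would put \<open>v * v\<close>
  into \<open>nrd f\<close>.\<close>

lemma irreducible_nrd_factor: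
  assumes f: "f \<noteq> 0" "nrd f \<in> central_multiples f" "f = a \<star> (q \<star> b)" and q: "skew_irreducible \<delta> q"
    and squarefree: "\<And>v. irreducible v \<Longrightarrow> \<not> v * v dvd nrd f"
  shows "irreducible (nrd q)"
proof -
  have ne: "a \<noteq> 0" "q \<noteq> 0" "b \<noteq> 0"
    using f by auto
  have "nrd f \<in> central_multiples q"
    using f ne central_multiples_left_factor central_multiples_right_factor by metis
  then obtain v where v: "irreducible v" "v \<in> central_multiples q" "v dvd nrd q"
    using irreducible_central_multiple[OF q ne(2)] nrd_nonzero[OF f(1)] by blast
  then obtain w where w: "nrd q = v * w"
    by (auto elim: dvdE)
  have "w dvd 1"
  proof (rule ccontr)
    assume "\<not> w dvd 1"
    moreover have "w \<noteq> 0"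
      using w nrd_nonzero[OF ne(2)] by auto
    ultimately obtain u where u: "irreducible u" "u dvd w"
      using poly_exists_irreducible_factor by blast
    then have "u dvd v ^ n"
      using nrd_dvd_power[OF v(2)] w dvd_trans by (metis dvd_mult)
    then have "v dvd u"
      using u(1) v(1) irreducible_dvd_power_imp_dvd irreducible_dvd_irreducible by blast
    then have "v * v dvd nrd q"
      unfolding w using u(2) by (intro mult_dvd_mono) (auto intro: dvd_trans)
    then have "v * v dvd nrd f"
      unfolding f(3) nrd_mult by (simp add: dvd_mult dvd_mult2)
    then show False
      using squarefree v(1) by blast
  qed
  then show ?thesis
    using v(1) irreducible_mult_unit_left[of w v] by (simp add: w mult.commute)
qed

text \<open>\<open>map nrd fs\<close> and \<open>hs\<close> both factor \<open>nrd f\<close> into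
  monic irreducibles, so their sets agree by unique factorization; squarefreeness rules out
  repetitions.\<close>

lemma map_nrd_decomposition:
  assumes f: "nrd_minimal f" "nrd f = prod_list hs"
    and hs: "\<And>q. q \<in> set hs \<Longrightarrow> irreducible q \<and> lead_coeff q = 1" "distinct hs"
    and fs: "fs \<in> irreducible_decompositions \<delta> f"
  shows "\<And>q. q \<in> set fs \<Longrightarrow> irreducible (nrd q)"
    and "map nrd fs \<in> permutations_of_set (set hs)"
proof -
  have monic_fs: "\<And>q. q \<in> set fs \<Longrightarrow> lead_coeff q = 1" and irr_fs: "\<And>q. q \<in> set fs \<Longrightarrow> skew_irreducible \<delta> q"
    and prod: "skew_prod \<delta> fs = f"
    using fs by (auto simp: irreducible_decompositions_def)
  have squarefree: "\<not> v * v dvd nrd f" if "irreducible v" for v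
    unfolding f(2) using distinct_irreducible_prod_squarefree hs that by blast
  have f_ne: "f \<noteq> 0" "nrd f \<in> central_multiples f"
    using f(1) by (auto simp: nrd_minimal_def)
  show irr: "irreducible (nrd q)" if "q \<in> set fs" for q
  proof -
    obtain as bs where "fs = as @ q # bs"
      using \<open>q \<in> set fs\<close> by (meson split_list)
    then have "f = skew_prod \<delta> as \<star> (q \<star> skew_prod \<delta> bs)"
      using prod by simp
    then show ?thesis
      using irreducible_nrd_factor[OF f_ne _ irr_fs[OF that] squarefree] by blast
  qed
  have monic: "lead_coeff (nrd q) = 1" if "q \<in> set fs" for q
    using monic_nrd[OF monic_fs[OF that] refl] by simp
  have prod_eq: "prod_list (map nrd fs) = prod_list hs"
    using prod f(2) nrd_skew_prod[of fs] by simp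
  have match: "\<exists>u\<in>set us. u = v" if "irreducible v" "lead_coeff v = 1" "v dvd prod_list us"
    "\<And>u. u \<in> set us \<Longrightarrow> irreducible u \<and> lead_coeff u = 1" for v :: "'f poly" and us
    using irreducible_dvd_prod_list[OF that(1,3)] that(1,2,4) irreducible_dvd_irreducible monic_dvd_antisym
    by metis
  have "set (map nrd fs) = set hs"
  proof (rule equalityI; rule subsetI)
    fix v assume v: "v \<in> set (map nrd fs)"
    then have "v dvd prod_list hs"
      using prod_list_dvd[of v "map nrd fs"] prod_eq by simp
    then show "v \<in> set hs"
      using match[of v hs] v irr monic hs(1) by auto
  next
    fix v assume v: "v \<in> set hs"
    then have "v dvd prod_list (map nrd fs)"
      using prod_list_dvd[of v hs] prod_eq by simp
    then show "v \<in> set (map nrd fs)"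
      using match[of v "map nrd fs"] v irr monic hs(1) by auto
  qed
  moreover have "distinct (map nrd fs)"
  proof (rule ccontr)
    assume "\<not> distinct (map nrd fs)"
    then obtain as bs cs v where split: "map nrd fs = as @ [v] @ bs @ [v] @ cs"
      using not_distinct_decomp by blast
    then have "v \<in> set (map nrd fs)"
      by simp
    then have "irreducible v"
      using irr by auto
    moreover have "v * v dvd nrd f"
      using f(2) prod_eq[symmetric] split by (simp add: mult_ac)
    ultimately show False
      using squarefree by blast
  qed
  ultimately show "map nrd fs \<in> permutations_of_set (set hs)"
    by (auto intro: permutations_of_setI)
qed

lemma map_nrd_bij:
  assumes f: "nrd_minimal f" "nrd f = prod_list hs"
    and hs: "\<And>q. q \<in> set hs \<Longrightarrow> irreducible q \<and> lead_coeff q = 1" "distinct hs"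
  shows "bij_betw (map nrd) (irreducible_decompositions \<delta> f) (permutations_of_set (set hs))"
proof (rule bij_betwI')
  fix fs fs' assume fs: "fs \<in> irreducible_decompositions \<delta> f" "fs' \<in> irreducible_decompositions \<delta> f"
  show "(map nrd fs = map nrd fs') = (fs = fs')"
  proof
    assume eq: "map nrd fs = map nrd fs'"
    show "fs = fs'"
      by (rule decomposition_unique[OF f(1) _ _ eq])
        (use fs map_nrd_decomposition(1)[OF f hs] in \<open>auto simp: irreducible_decompositions_def\<close>)
  qed simp
next
  show "map nrd fs \<in> permutations_of_set (set hs)" if "fs \<in> irreducible_decompositions \<delta> f" for fs
    using map_nrd_decomposition(2)[OF f hs that] .
next
  fix us assume "us \<in> permutations_of_set (set hs)"
  then have us: "set us = set hs" "distinct us"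
    by (auto dest: permutations_of_setD)
  \<comment> \<open>Every ordering of the factors has the same product, so
    \<open>decomposition_exists\<close> applies to each of them.\<close>
  then have "prod_list us = prod_list hs"
    using hs(2) by (metis prod.distinct_set_conv_list list.map_ident)
  then obtain fs where "fs \<in> irreducible_decompositions \<delta> f" "map nrd fs = us"
    using decomposition_exists[OF f(1), of us] f(2) hs(1) us(1) by auto
  then show "\<exists>fs\<in>irreducible_decompositions \<delta> f. us = map nrd fs"
    by blast
qed

theorem skew_factorization:
  assumes f: "nrd_minimal f"
  shows
    "(\<forall>hs. (\<forall>q \<in> set hs. irreducible q \<and> lead_coeff q = 1) \<and> N f = to_fract (prod_list hs) \<longrightarrow>
        (\<exists>fs. length fs = length hs \<and> (\<forall>q \<in> set fs. skew_irreducible \<delta> q) \<and>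
           skew_prod \<delta> fs = f \<and>
           (\<forall>i < length hs. N (fs ! i) = to_fract (hs ! i) \<and>
              degree (hs ! i) = d * degree (fs ! i)))) \<and>
     (\<forall>hs. (\<forall>q \<in> set hs. irreducible q \<and> lead_coeff q = 1) \<and> distinct hs \<and>
        N f = to_fract (prod_list hs) \<longrightarrow>
        card (irreducible_decompositions \<delta> f) = fact (length hs) \<and>
        bij_betw (map N) (irreducible_decompositions \<delta> f) (permutations_of_set (to_fract ` set hs)))"
proof (intro conjI allI impI; elim conjE)
  fix hs assume hs: "\<forall>q \<in> set hs. irreducible q \<and> lead_coeff q = 1" "N f = to_fract (prod_list hs)"
  then have "nrd f = prod_list hs"
    by (simp add: N_eq)
  then obtain fs where fs: "fs \<in> irreducible_decompositions \<delta> f" "map nrd fs = hs"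
    using decomposition_exists[OF f] hs(1) by blast
  have len: "length fs = length hs" and nth: "\<And>i. i < length hs \<Longrightarrow> nrd (fs ! i) = hs ! i"
    using fs(2) by auto
  have "degree (hs ! i) = d * degree (fs ! i)" if "i < length hs" for i
  proof -
    have "lead_coeff (fs ! i) = 1"
      using fs(1) that len by (simp add: irreducible_decompositions_def)
    then show ?thesis
      using monic_nrd(2)[of "fs ! i"] nth[OF that] by simp
  qed
  then show "\<exists>fs. length fs = length hs \<and> (\<forall>q \<in> set fs. skew_irreducible \<delta> q) \<and> skew_prod \<delta> fs = f \<and>
      (\<forall>i < length hs. N (fs ! i) = to_fract (hs ! i) \<and> degree (hs ! i) = d * degree (fs ! i))"
    using fs(1) len nth by (intro exI[of _ fs]) (auto simp: N_eq irreducible_decompositions_def)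
next
  fix hs assume hs: "\<forall>q \<in> set hs. irreducible q \<and> lead_coeff q = 1" "distinct hs"
    "N f = to_fract (prod_list hs)"
  have bij: "bij_betw (map nrd) (irreducible_decompositions \<delta> f) (permutations_of_set (set hs))"
    by (rule map_nrd_bij[OF f]) (use hs in \<open>auto simp: N_eq\<close>)
  then have "card (irreducible_decompositions \<delta> f) = card (permutations_of_set (set hs))"
    by (rule bij_betw_same_card)
  then show "card (irreducible_decompositions \<delta> f) = fact (length hs)"
    using hs(2) by (simp add: distinct_card)
  \<comment> \<open>\<open>N\<close> takes its values in \<open>F(x)\<close>; injectivity of
    \<open>to_fract\<close> transports the bijection there.\<close>
  have "inj_on (map to_fract) (permutations_of_set (set hs))"
    by (rule inj_onI) (simp add: inj_map_eq_map inj_on_def)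
  moreover have "map to_fract ` permutations_of_set (set hs) = permutations_of_set (to_fract ` set hs)"
    by (rule permutations_of_set_image_inj[symmetric]) (simp add: inj_on_def)
  ultimately have "bij_betw (map to_fract) (permutations_of_set (set hs)) (permutations_of_set (to_fract ` set hs))"
    by (simp add: bij_betw_def)
  from bij_betw_trans[OF bij this]
  have "bij_betw (map to_fract \<circ> map nrd) (irreducible_decompositions \<delta> f)
    (permutations_of_set (to_fract ` set hs))" .
  moreover have "map to_fract \<circ> map nrd = map N"
    by (intro ext) (simp add: N_eq)
  ultimately show "bij_betw (map N) (irreducible_decompositions \<delta> f) (permutations_of_set (to_fract ` set hs))"
    by simp
qed

end

subsection \<open>The ring of central quotients\<close>

context skew_center
begin

lemma fraction_iff:
  "(f', q') \<in> fraction R \<kappa> f q \<longleftrightarrow> q \<noteq> 0 \<and> q' \<noteq> 0 \<and> \<kappa> q' \<star> f = \<kappa> q \<star> f'"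
  by (auto simp: fraction_def fraction_rel_def)

lemma fraction_scale: "b \<noteq> 0 \<Longrightarrow> fraction R \<kappa> (\<kappa> b \<star> f) b = fraction R \<kappa> f 1"
proof -
  assume b: "b \<noteq> 0"
  have "\<kappa> r \<star> (\<kappa> b \<star> f) = \<kappa> b \<star> y \<longleftrightarrow> \<kappa> r \<star> f = y" for r y
  proof -
    have "\<kappa> r \<star> (\<kappa> b \<star> f) = \<kappa> b \<star> (\<kappa> r \<star> f)"
      by (simp only: skew_assoc[symmetric] \<kappa>_comm[of r "\<kappa> b"])
    then show ?thesis
      using b skew_cancel_left[of "\<kappa> b"] by auto
  qed
  then show ?thesis
    using b by (auto simp: fraction_iff)
qed

lemma fraction_1_iff: "(y, b) \<in> fraction R \<kappa> f 1 \<longleftrightarrow> b \<noteq> 0 \<and> y = \<kappa> b \<star> f"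
  by (auto simp: fraction_iff)

lemma fraction_1_carrier: "fraction R \<kappa> f 1 \<in> carrier (central_quotients R \<kappa>)"
  unfolding central_quotients_def by simp (metis one_neq_zero)

text \<open>The operations on fractions are unions over all representatives. Those of
  \<open>f / 1\<close> are exactly the pairs \<open>(\<kappa> b \<star> f, b)\<close> with
  \<open>b\<close> nonzero, so independence of \<open>b\<close>, \<open>b'\<close> makes the union
  one over a constant family.\<close>

lemma UN_fraction_1:
  assumes "\<And>b b'. b \<noteq> 0 \<Longrightarrow> b' \<noteq> 0 \<Longrightarrow> F (\<kappa> b \<star> f) b (\<kappa> b' \<star> q) b' = S"
  shows "(\<Union>(y, b) \<in> fraction R \<kappa> f 1. \<Union>(y', b') \<in> fraction R \<kappa> q 1. F y b y' b') = S"
proof -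
  have P: "([:1:] \<star> f, 1) \<in> fraction R \<kappa> f 1" and Q: "([:1:] \<star> q, 1) \<in> fraction R \<kappa> q 1"
    by (simp_all add: fraction_1_iff)
  have "F (fst z) (snd z) (fst z') (snd z') = S"
    if "z \<in> fraction R \<kappa> f 1" "z' \<in> fraction R \<kappa> q 1" for z z'
    using assms that by (cases z; cases z') (simp add: fraction_1_iff)
  then show ?thesis
    unfolding case_prod_unfold by (intro UN_constant_eq[OF P] UN_constant_eq[OF Q] ballI) blast
qed

lemma fraction_1_mult:
  "fraction R \<kappa> f 1 \<otimes>\<^bsub>central_quotients R \<kappa>\<^esub> fraction R \<kappa> q 1 = fraction R \<kappa> (f \<star> q) 1"
proof -
  have "fraction R \<kappa> (\<kappa> b \<star> f \<star> (\<kappa> b' \<star> q)) (b * b') = fraction R \<kappa> (f \<star> q) 1"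
    if "b \<noteq> 0" "b' \<noteq> 0" for b b'
  proof -
    have "\<kappa> b \<star> f \<star> (\<kappa> b' \<star> q) = \<kappa> b \<star> (f \<star> \<kappa> b') \<star> q"
      by (simp only: skew_assoc)
    also have "\<dots> = \<kappa> (b * b') \<star> (f \<star> q)"
      by (simp only: \<kappa>_comm[of b' f, symmetric] \<kappa>_mult skew_assoc)
    finally show ?thesis
      using that by (simp add: fraction_scale)
  qed
  then show ?thesis
    by (simp add: central_quotients_def UN_fraction_1)
qed

lemma fraction_1_add:
  "fraction R \<kappa> f 1 \<oplus>\<^bsub>central_quotients R \<kappa>\<^esub> fraction R \<kappa> q 1 = fraction R \<kappa> (f + q) 1"
proof -
  have "fraction R \<kappa> (\<kappa> b' \<star> (\<kappa> b \<star> f) + \<kappa> b \<star> (\<kappa> b' \<star> q)) (b * b') = fraction R \<kappa> (f + q) 1"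
    if "b \<noteq> 0" "b' \<noteq> 0" for b b'
  proof -
    have "\<kappa> b' \<star> (\<kappa> b \<star> f) = \<kappa> (b * b') \<star> f"
      by (simp only: mult.commute[of b] \<kappa>_mult skew_assoc)
    moreover have "\<kappa> b \<star> (\<kappa> b' \<star> q) = \<kappa> (b * b') \<star> q"
      by (simp only: \<kappa>_mult skew_assoc)
    ultimately show ?thesis
      using that fraction_scale[of "b * b'" "f + q"] by (simp add: skew_add_right)
  qed
  then show ?thesis
    by (simp add: central_quotients_def UN_fraction_1)
qed

text \<open>The union over representatives \<open>a / b\<close> has a single member, since
  \<open>a = b * u\<close> and \<open>\<kappa> b\<close> cancels.\<close>

lemma central_scalar_fract: "central_scalar R \<kappa> (Fraction_Field.Fract u 1) = fraction R \<kappa> (\<kappa> u) 1"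
proof -
  have *: "fraction R \<kappa> (\<kappa> a) b = fraction R \<kappa> (\<kappa> u) 1"
    if "b \<noteq> 0" "Fraction_Field.Fract a b = Fraction_Field.Fract u 1" for a b
  proof -
    have "a = b * u"
      using that by (simp add: eq_fract mult.commute)
    then show ?thesis
      using that(1) by (simp add: \<kappa>_mult fraction_scale)
  qed
  have "{fraction R \<kappa> (\<kappa> a) b |a b. b \<noteq> 0 \<and> Fraction_Field.Fract a b = Fraction_Field.Fract u 1} =
      {fraction R \<kappa> (\<kappa> u) 1}"
  proof (rule equalityI; rule subsetI)
    fix P assume "P \<in> {fraction R \<kappa> (\<kappa> u) 1}"
    then show "P \<in> {fraction R \<kappa> (\<kappa> a) b |a b. b \<noteq> 0 \<and> Fraction_Field.Fract a b = Fraction_Field.Fract u 1}"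
      by (intro CollectI exI[of _ u] exI[of _ 1]) simp
  next
    fix P assume "P \<in> {fraction R \<kappa> (\<kappa> a) b |a b. b \<noteq> 0 \<and> Fraction_Field.Fract a b = Fraction_Field.Fract u 1}"
    then obtain a b where ab: "P = fraction R \<kappa> (\<kappa> a) b" "b \<noteq> 0"
      "Fraction_Field.Fract a b = Fraction_Field.Fract u 1"
      by blast
    then show "P \<in> {fraction R \<kappa> (\<kappa> u) 1}"
      using *[OF ab(2,3)] by blast
  qed
  then show ?thesis
    by (simp add: central_scalar_def)
qed

end

section \<open>From the assumptions of the theorem to the locales\<close>

lemma ring_of_type_algebra_ring: "ring (ring_of_type_algebra :: 'a::ring_1 ring)"
proof (rule ringI)
  show "abelian_group (ring_of_type_algebra :: 'a ring)"
    by (rule abelian_groupI) (auto simp: ring_of_type_algebra_def algebra_simps intro: exI[of _ "- _"])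
  show "monoid (ring_of_type_algebra :: 'a ring)"
    by (rule monoidI) (auto simp: ring_of_type_algebra_def mult.assoc)
qed (auto simp: ring_of_type_algebra_def algebra_simps)

text \<open>\<open>ring.dimension\<close> is defined inductively by adjoining one line at a time,
  and the spanning set grows along with it.\<close>

lemma dimension_finite_spanning:
  fixes V :: "'a::ring_1 set"
  assumes "ring.dimension ring_of_type_algebra k C V" and "C = center ring_of_type_algebra"
  shows "\<exists>B. finite B \<and> (\<forall>a\<in>V. \<exists>u. (\<forall>b\<in>B. u b \<in> C) \<and> a = (\<Sum>b\<in>B. u b * b))"
proof -
  interpret D: ring "ring_of_type_algebra :: 'a ring"
    by (rule ring_of_type_algebra_ring)
  show ?thesis
    using assms
  proof (induction k C V rule: D.dimension.induct)
    case (zero_dim K)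
    then show ?case
      by (intro exI[of _ "{}"]) (simp add: ring_of_type_algebra_def)
  next
    case (Suc_dim v V k K)
    have K: "0 \<in> K" "\<And>a b. a \<in> K \<Longrightarrow> b \<in> K \<Longrightarrow> a + b \<in> K"
      using Suc_dim.prems by (auto simp: center_def ring_of_type_algebra_def algebra_simps)
    obtain B where B: "finite B" "\<forall>a\<in>V. \<exists>u. (\<forall>b\<in>B. u b \<in> K) \<and> a = (\<Sum>b\<in>B. u b * b)"
      using Suc_dim.IH Suc_dim.prems by blast
    have "\<exists>u. (\<forall>b\<in>insert v B. u b \<in> K) \<and> a = (\<Sum>b\<in>insert v B. u b * b)"
      if a: "a \<in> D.line_extension K v V" for a
    proof -
      obtain c w where w: "c \<in> K" "w \<in> V" "a = c * v + w"
        using a unfolding D.line_extension_mem_iff by (auto simp: ring_of_type_algebra_def)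
      obtain u where u: "\<forall>b\<in>B. u b \<in> K" "w = (\<Sum>b\<in>B. u b * b)"
        using B(2) w(2) by blast
      \<comment> \<open>\<open>v\<close> may already be in \<open>B\<close>; so both coefficient
        functions are extended by zero and added instead of one overwriting the other.\<close>
      define u1 u2 where "u1 b = (if b \<in> B then u b else 0)" and "u2 b = (if b = v then c else 0)" for b
      have "(\<Sum>b\<in>insert v B. u1 b * b) = (\<Sum>b\<in>B. u b * b)"
        using B(1) by (intro sum.mono_neutral_cong_right) (auto simp: u1_def)
      moreover have "(\<Sum>b\<in>insert v B. u2 b * b) = (\<Sum>b\<in>{v}. c * b)"
        using B(1) by (intro sum.mono_neutral_cong_right) (auto simp: u2_def)
      ultimately have "a = (\<Sum>b\<in>insert v B. (u1 b + u2 b) * b)"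
        using w(3) u(2) by (simp add: distrib_right sum.distrib add.commute)
      moreover have "\<forall>b\<in>insert v B. u1 b + u2 b \<in> K"
        using K u(1) w(1) by (auto simp: u1_def u2_def)
      ultimately show ?thesis
        by (intro exI[of _ "\<lambda>b. u1 b + u2 b"] conjI)
    qed
    then show ?case
      using B(1) by (intro exI[of _ "insert v B"]) simp
  qed
qed

lemma p_polynomial_coeff:
  fixes c :: "nat \<Rightarrow> 'f::field"
  assumes p: "prime (p::nat)"
    and g: "g = Polynomial.monom 1 (p ^ e) + (\<Sum>i=1..e. Polynomial.monom (c i) (p ^ (e - i)))"
  shows "coeff g i \<noteq> 0 \<Longrightarrow> \<exists>k. i = p ^ k" and "degree g = p ^ e"
proof -
  have coeff_g: "coeff g i = (if p ^ e = i then 1 else 0) + (\<Sum>j=1..e. if p ^ (e - j) = i then c j else 0)" for i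
    by (simp add: g coeff_sum)
  show "\<exists>k. i = p ^ k" if "coeff g i \<noteq> 0"
  proof (rule ccontr)
    assume "\<nexists>k. i = p ^ k"
    then have "coeff g i = 0"
      unfolding coeff_g by (auto intro!: sum.neutral)
    then show False
      using that by simp
  qed
  have less: "p ^ (e - j) < p ^ e" if "j \<in> {1..e}" for j
    using that prime_gt_1_nat[OF p] by (intro power_strict_increasing) auto
  have "coeff g i = (if i = p ^ e then 1 else 0)" if "i \<ge> p ^ e" for i
  proof -
    have "(\<Sum>j=1..e. if p ^ (e - j) = i then c j else 0) = 0"
    proof (rule sum.neutral, rule ballI)
      fix j assume "j \<in> {1..e}"
      then show "(if p ^ (e - j) = i then c j else 0) = 0"
        using less[of j] that by auto
    qed
    then show ?thesis
      by (simp add: coeff_g)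
  qed
  then have "coeff g (p ^ e) = 1" "\<And>i. i > p ^ e \<Longrightarrow> coeff g i = 0"
    by auto
  then show "degree g = p ^ e"
    by (intro antisym degree_le le_degree) auto
qed

theorem corollary30:
  fixes \<delta> :: "'a::division_ring \<Rightarrow> 'a"
    and \<iota> :: "'f::field \<Rightarrow> 'a"
    and C :: "'a set"
    and p d e m :: nat
    and c :: "nat \<Rightarrow> 'f"
    and g hhat :: "'f poly"
    and d\<^sub>0 :: 'a
    and x f h :: "'a poly"
    and R :: "'a poly ring"
    and \<kappa> :: "'f poly \<Rightarrow> 'a poly"
    and Nrd :: "('a poly \<times> 'f poly) set \<Rightarrow> 'f poly fract"
    and N :: "'a poly \<Rightarrow> 'f poly fract"
  assumes "prime p" and "CHAR('a) = p"
    and C: "C = center ring_of_type_algebra"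
    and "ring.dimension ring_of_type_algebra (d\<^sup>2) C UNIV"
    and "is_derivation \<delta>"
    and "Ring_Hom.ring_hom \<iota>" and "range \<iota> = {a. \<delta> a = 0} \<inter> C"
    and "is_minimum_polynomial_on \<iota> \<delta> C g"
    and "g = Polynomial.monom 1 (p ^ e) + (\<Sum>i=1..e. Polynomial.monom (c i) (p ^ (e - i)))"
    and "\<And>z. poly_in_derivation \<iota> \<delta> g z = d\<^sub>0 * z - z * d\<^sub>0"
    and "\<delta> d\<^sub>0 = 0"
    and R: "R = skew_ring \<delta>"
    and x: "x = map_poly \<iota> g - [:d\<^sub>0:]"
    and \<kappa>: "\<kappa> = eval_at \<iota> \<delta> x"
    and "is_reduced_norm (central_quotients R \<kappa>) (central_scalar R \<kappa>) (p ^ e * d) Nrd"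
    and N: "N = (\<lambda>q. Nrd (fraction R \<kappa> q 1))"
    and "lead_coeff f = 1" and "Polynomial.degree f = m"
    and "minimal_central_left_multiple \<delta> f h" and "h = \<kappa> hhat" and "lead_coeff hhat = 1"
    and "Polynomial.degree hhat = d * m"
  shows
    "(\<forall>hs. (\<forall>q \<in> set hs. Factorial_Ring.irreducible q \<and> lead_coeff q = 1) \<and>
        N f = Fraction_Field.Fract (prod_list hs) 1 \<longrightarrow>
        (\<exists>fs. length fs = length hs \<and> (\<forall>q \<in> set fs. skew_irreducible \<delta> q) \<and>
           skew_prod \<delta> fs = f \<and>
           (\<forall>i < length hs. N (fs ! i) = Fraction_Field.Fract (hs ! i) 1 \<and>
              Polynomial.degree (hs ! i) = d * Polynomial.degree (fs ! i)))) \<and>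
     (\<forall>hs. (\<forall>q \<in> set hs. Factorial_Ring.irreducible q \<and> lead_coeff q = 1) \<and> distinct hs \<and>
        N f = Fraction_Field.Fract (prod_list hs) 1 \<longrightarrow>
        card (irreducible_decompositions \<delta> f) = fact (length hs) \<and>
        bij_betw (map N) (irreducible_decompositions \<delta> f)
          (permutations_of_set ((\<lambda>q. Fraction_Field.Fract q 1) ` set hs)))"
proof -
  have C': "C = {z. \<forall>y. z * y = y * z}"
    unfolding C by (simp add: center_def ring_of_type_algebra_def)
  have center_R: "center (skew_ring \<delta>) = {z. \<forall>y. skew_mult \<delta> z y = skew_mult \<delta> y z}"
    by (simp add: center_def skew_ring_def)
  obtain B where "finite B" "\<forall>a\<in>UNIV. \<exists>u. (\<forall>b\<in>B. u b \<in> C) \<and> a = (\<Sum>b\<in>B. u b * b)"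
    using dimension_finite_spanning[OF assms(4) C] by blast
  then have spanning: "\<exists>B :: 'a set. finite B \<and>
      (\<forall>a. \<exists>u. (\<forall>b\<in>B. u b \<in> {z. \<forall>y. z * y = y * z}) \<and> a = (\<Sum>b\<in>B. u b * b))"
    unfolding C' by blast
  interpret S: skew_center \<delta> \<iota> p e g d\<^sub>0
  proof (intro skew_center.intro skew_center_axioms.intro skew_polynomials.intro; (fact)?)
    show "range \<iota> = {a. \<delta> a = 0} \<inter> {z. \<forall>y. z * y = y * z}"
      using assms(7) unfolding C' .
    show "\<exists>k. i = p ^ k" if "coeff g i \<noteq> 0" for i
      using p_polynomial_coeff(1)[OF assms(1,9) that] .
    show "degree g = p ^ e"
      using p_polynomial_coeff(2)[OF assms(1,9)] .
    show "lead_coeff g = 1"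
      using assms(8) by (simp add: is_minimum_polynomial_on_def)
  qed
  have \<kappa>_eq: "\<kappa> = S.\<kappa>"
    unfolding \<kappa> x S.x_def[symmetric] by (rule S.eval_at_x)
  let ?A = "central_quotients R \<kappa>" and ?n = "p ^ e * d"
  obtain \<phi> where \<phi>: "is_splitting ?A (central_scalar R \<kappa>) ?n \<phi>"
    "\<forall>a \<in> carrier ?A. to_ac (Nrd a) = det (\<phi> a)"
    using assms(15) unfolding is_reduced_norm_def by blast
  define \<psi> where "\<psi> q = \<phi> (fraction R \<kappa> q 1)" for q
  have in_A: "fraction R \<kappa> q 1 \<in> carrier ?A" for q
    unfolding R \<kappa>_eq by (rule S.fraction_1_carrier)
  \<comment> \<open>Dimension 0 would make \<open>D\<close> the zero ring. Positivity of
    \<open>d\<close> makes the matrix size positive and allows cancelling \<open>d\<close> when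
    degrees are compared.\<close>
  have "d \<noteq> 0"
  proof
    assume "d = 0"
    interpret D: ring "ring_of_type_algebra :: 'a ring"
      by (rule ring_of_type_algebra_ring)
    have "D.dimension 0 C UNIV"
      using assms(4) \<open>d = 0\<close> by simp
    then have "(UNIV :: 'a set) = {\<zero>\<^bsub>ring_of_type_algebra\<^esub>}"
      by (cases rule: D.dimension.cases) simp
    then show False
      by (metis UNIV_I singletonD zero_neq_one)
  qed
  have \<phi>_carrier: "\<And>a. a \<in> carrier ?A \<Longrightarrow> \<phi> a \<in> carrier_mat ?n ?n"
    and \<phi>_add: "\<And>a b. a \<in> carrier ?A \<Longrightarrow> b \<in> carrier ?A \<Longrightarrow> \<phi> (a \<oplus>\<^bsub>?A\<^esub> b) = \<phi> a + \<phi> b"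
    and \<phi>_mult: "\<And>a b. a \<in> carrier ?A \<Longrightarrow> b \<in> carrier ?A \<Longrightarrow> \<phi> (a \<otimes>\<^bsub>?A\<^esub> b) = \<phi> a * \<phi> b"
    and \<phi>_scalar: "\<And>k. \<phi> (central_scalar R \<kappa> k) = to_ac k \<cdot>\<^sub>m 1\<^sub>m ?n"
    using \<phi>(1) unfolding is_splitting_def by simp_all
  interpret S: skew_norm \<delta> \<iota> p e g d\<^sub>0 d ?n \<psi> N
  proof unfold_locales
    fix q r u
    show "\<psi> q \<in> carrier_mat ?n ?n"
      unfolding \<psi>_def by (rule \<phi>_carrier[OF in_A])
    show "\<psi> (q + r) = \<psi> q + \<psi> r"
      using \<phi>_add[OF in_A in_A, of q r] unfolding \<psi>_def R \<kappa>_eq S.fraction_1_add .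
    show "\<psi> (skew_mult \<delta> q r) = \<psi> q * \<psi> r"
      using \<phi>_mult[OF in_A in_A, of q r] unfolding \<psi>_def R \<kappa>_eq S.fraction_1_mult .
    show "\<psi> (S.\<kappa> u) = to_ac (to_fract u) \<cdot>\<^sub>m 1\<^sub>m ?n"
      using \<phi>_scalar[of "to_fract u"] unfolding \<psi>_def R \<kappa>_eq to_fract_def S.central_scalar_fract .
    show "det (\<psi> q) = to_ac (N q)"
      using \<phi>(2) in_A[of q] unfolding \<psi>_def N by simp
    show "?n = S.E * d"
      by (simp add: S.E_def)
    show "d > 0"
      using \<open>d \<noteq> 0\<close> by simp
  qed
  have "S.nrd_minimal f"
  proof (rule S.nrd_minimalI)
    show "lead_coeff f = 1" "degree f = m" "lead_coeff hhat = 1" "degree hhat = d * m"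
      by fact+
    have h: "\<exists>q. h = skew_mult \<delta> q f"
      and min: "\<And>k. k \<in> center (skew_ring \<delta>) \<Longrightarrow> k \<noteq> 0 \<Longrightarrow> \<exists>q. k = skew_mult \<delta> q f \<Longrightarrow> degree h \<le> degree k"
      using assms(19) by (auto simp: minimal_central_left_multiple_def)
    show "hhat \<in> S.central_multiples f"
      using h by (simp add: S.central_multiples_def assms(20) \<kappa>_eq)
    fix u assume u: "u \<in> S.central_multiples f" "u \<noteq> 0"
    \<comment> \<open>Minimality is given for degrees in \<open>t\<close> over the centre of
      \<open>R\<close>. On the elements \<open>\<kappa> u\<close> it becomes minimality of degrees
      in \<open>x\<close>, as \<open>\<kappa>\<close> multiplies degrees by
      \<open>E\<close>.\<close>
    have "S.\<kappa> u \<in> center (skew_ring \<delta>)"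
      unfolding center_R using S.\<kappa>_comm[of u] by simp
    then have "degree (S.\<kappa> hhat) \<le> degree (S.\<kappa> u)"
      using min[of "S.\<kappa> u"] u by (simp add: S.central_multiples_def assms(20) \<kappa>_eq)
    then show "degree hhat \<le> degree u"
      using S.E_pos by simp
  qed
  from S.skew_factorization[OF this] show ?thesis
    unfolding to_fract_def[abs_def] .
qed

end
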